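(* Let $G=G_{N_1}^{(1)}\times\ldots\times G_{N_s}^{(s)}\subset U_N^+$, $N=N_1\ldots N_s$, be a product of easy quantum groups $G_{N_r}^{(r)}\subset U_{N_r}^+$, with $D^{(r)}\subset P$ being the category of partitions associated to $G_{N_r}^{(r)}$, and let $I=\{(c,\ldots,c)\mid c\in J\}$ for a nonempty set $J\subset\{1,\ldots,\min_rN_r\}$. Then the space $X_{G,I}\subset S^{N-1}_{\mathbb C,+}$ appears by imposing the relations $$\sum_{i_1\ldots i_k}\delta_\pi(i_1\ldots i_k)x_{i_1}^{e_1}\ldots x_{i_k}^{e_k}=|J|^{|\pi_1\vee\ldots\vee\pi_s|-k/2},$$ for all colored integers $k=e_1\ldots e_k$ and all $\pi=(\pi_1,\ldots,\pi_s)\in D^{(1)}(k)\times\ldots\times D^{(s)}(k)$, where $\pi_1\vee\ldots\vee\pi_s\in P(k)$ is the partition obtained by superposing $\pi_1,\ldots,\pi_s$. That is, $C(X_{G,I})$ is the quotient of $C(S^{N-1}_{\mathbb C,+})$ by these relations.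
   Context: Compact quantum groups. A finitely generated Hopf $C^*$-algebra is a unital $C^*$-algebra $A$ with a unitary matrix $u=(u_{ij})\in M_N(A)$ whose coefficients generate $A$, such that $\Delta(u_{ij})=\sum_ku_{ik}\otimes u_{kj}$, $\varepsilon(u_{ij})=\delta_{ij}$, $S(u_{ij})=u_{ji}^*$ define morphisms of $C^*$-algebras $\Delta:A\to A\otimes A$, $\varepsilon:A\to\mathbb C$, $S:A\to A^{opp}$. One writes $A=C(G)$, with $G$ a compact quantum group. $C(U_N^+)$ is the universal $C^*$-algebra generated by $u_{ij}$, $1\le i,j\le N$, with $u^*=u^{-1}$, $u^t=\bar u^{-1}$, and $C(S^{N-1}_{\mathbb C,+})$ is the universal $C^*$-algebra generated by $x_1,\ldots,x_N$ with $\sum_ix_ix_i^*=\sum_ix_i^*x_i=1$. A closed quantum subgroup $G\subset U_N^+$ is given by a morphism $C(U_N^+)\to C(G)$ mapping standard coordinates to standard coordinates. Products: if $G^{(r)}\subset U_{N_r}^+$ has fundamental corepresentation $u^{(r)}$, then $G=G^{(1)}\times\ldots\times G^{(s)}$ is given by $C(G)=C(G^{(1)})\otimes\ldots\otimes C(G^{(s)})$, with fundamental corepresentation $u_{i,j}=u^{(1)}_{i^1j^1}\otimes\ldots\otimes u^{(s)}_{i^sj^s}$ for multi-indices $i=(i^1,\ldots,i^s)$, $j=(j^1,\ldots,j^s)$ with $i^r,j^r\in\{1,\ldots,N_r\}$. Thus $G\subset U_N^+$, $N=N_1\ldots N_s$, and the coordinates of $S^{N-1}_{\mathbb C,+}$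 are indexed by such multi-indices. Colored integers: $k=e_1\ldots e_k$ with $e_i\in\{\circ,\bullet\}$; $k$ also denotes the length. $x^\circ=x$, $x^\bullet=x^*$, and similarly for $u_{ij}$. $u^{\otimes k}$ is the matrix with entries $u_{i_1j_1}^{e_1}\ldots u_{i_kj_k}^{e_k}$, $Hom(u^{\otimes k},u^{\otimes l})$ is the space of linear maps $T$ with $Tu^{\otimes k}=u^{\otimes l}T$, and $Fix(u^{\otimes k})=\{\xi\mid u^{\otimes k}\xi=\xi\}$. The space $X_{G,I}$ (for $G\subset U_N^+$ and a nonempty set $I$ of indices) is defined by letting $C(X_{G,I})$ be the quotient of $C(S^{N-1}_{\mathbb C,+})$ by the relations $\sum_{a_1\ldots a_k}\xi_{a_1\ldots a_k}x_{a_1}^{e_1}\ldots x_{a_k}^{e_k}=\frac{1}{\sqrt{|I|^k}}\sum_{b_1,\ldots,b_k\in I}\xi_{b_1\ldots b_k}$, for all $k$ and all $\xi\in Fix(u^{\otimes k})$. Easiness: $P(k,l)$ is the set of partitions with $k$ upper legs and $l$ lower legs. For $\pi\in P(k,l)$, $T_\pi(e_{i_1}\otimes\ldots\otimes e_{i_k})=\sum_{j_1\ldots j_l}\delta_\pi\binom{i_1\ldots i_k}{j_1\ldots j_l}e_{j_1}\otimes\ldots\otimes e_{j_l}$, where $\delta_\pi\in\{0,1\}$ equals $1$ when, putting the indices on the legs, each block of $\pi$ contains equal indices, and $0$ otherwise. A category of partitions is a collection of subsets $D(k,l)\subset P(k,l)$, one for each pair of colored integers $k,l$, stable under vertical and horizontal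 concatenation and under upside-down turning. A closed quantum subgroup $G\subset U_N^+$ is easy, coming from $D$, when $Hom(u^{\otimes k},u^{\otimes l})=span(T_\pi\mid\pi\in D(k,l))$ for all $k,l$. Put $D(k)=D(0,k)$ and $P(k)=P(0,k)$; $|\cdot|$ on partitions is the number of blocks. For $\pi=(\pi_1,\ldots,\pi_s)$ and multi-indices $i_t=(i_t^1,\ldots,i_t^s)$, $\delta_\pi(i_1\ldots i_k)=\prod_{r=1}^s\delta_{\pi_r}(i_1^r\ldots i_k^r)$. The superposition $\pi_1\vee\ldots\vee\pi_s$ is the join, i.e. the finest partition such that each block of each $\pi_r$ is contained in one of its blocks. *)

theory Defs
  imports Complex_Main "HOL-Library.Disjoint_Sets" "HOL-Library.FuncSet"
    "HOL-Algebra.Module" "HOL-Algebra.QuotRing"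
begin

section \<open>Unital C*-algebras\<close>

definition complex_ring :: "complex ring" where
  "complex_ring = \<lparr>carrier = UNIV, mult = (*), one = 1, zero = 0, add = (+)\<rparr>"

record 'a cstar = "(complex, 'a) module" +
  adj :: "'a \<Rightarrow> 'a"
  cnorm :: "'a \<Rightarrow> real"

text \<open>The zero algebra is allowed: the quotients considered below may vanish.\<close>

locale cstar_algebra = ring A + module complex_ring A for A :: "'a cstar" (structure) +
  assumes scale_mult_left: "x \<in> carrier A \<Longrightarrow> y \<in> carrier A \<Longrightarrow> (c \<odot> x) \<otimes> y = c \<odot> (x \<otimes> y)"
    and scale_mult_right: "x \<in> carrier A \<Longrightarrow> y \<in> carrier A \<Longrightarrow> x \<otimes> (c \<odot> y) = c \<odot> (x \<otimes> y)"
    and adj_closed: "x \<in> carrier A \<Longrightarrow> adj A x \<in> carrier A"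
    and adj_add: "x \<in> carrier A \<Longrightarrow> y \<in> carrier A \<Longrightarrow> adj A (x \<oplus> y) = adj A x \<oplus> adj A y"
    and adj_scale: "x \<in> carrier A \<Longrightarrow> adj A (c \<odot> x) = cnj c \<odot> adj A x"
    and adj_mult: "x \<in> carrier A \<Longrightarrow> y \<in> carrier A \<Longrightarrow> adj A (x \<otimes> y) = adj A y \<otimes> adj A x"
    and adj_adj: "x \<in> carrier A \<Longrightarrow> adj A (adj A x) = x"
    and cnorm_nonneg: "x \<in> carrier A \<Longrightarrow> 0 \<le> cnorm A x"
    and cnorm_eq_0_iff: "x \<in> carrier A \<Longrightarrow> cnorm A x = 0 \<longleftrightarrow> x = \<zero>"
    and cnorm_triangle: "x \<in> carrier A \<Longrightarrow> y \<in> carrier A \<Longrightarrow> cnorm A (x \<oplus> y) \<le> cnorm A x + cnorm A y"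
    and cnorm_scale: "x \<in> carrier A \<Longrightarrow> cnorm A (c \<odot> x) = cmod c * cnorm A x"
    and cnorm_mult: "x \<in> carrier A \<Longrightarrow> y \<in> carrier A \<Longrightarrow> cnorm A (x \<otimes> y) \<le> cnorm A x * cnorm A y"
    and cstar_identity: "x \<in> carrier A \<Longrightarrow> cnorm A (adj A x \<otimes> x) = (cnorm A x)\<^sup>2"
    and complete: "(\<And>n::nat. f n \<in> carrier A) \<Longrightarrow>
      (\<And>\<epsilon>. \<epsilon> > 0 \<Longrightarrow> \<exists>M. \<forall>m\<ge>M. \<forall>n\<ge>M. cnorm A (f m \<ominus> f n) < \<epsilon>) \<Longrightarrow>
      \<exists>a\<in>carrier A. (\<lambda>n. cnorm A (f n \<ominus> a)) \<longlonglongrightarrow> 0"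

definition complex_cstar :: "complex cstar" where
  "complex_cstar = \<lparr>carrier = UNIV, mult = (*), one = 1, zero = 0, add = (+),
     smult = (*), adj = cnj, cnorm = cmod\<rparr>"

lemma complex_cstar_algebra: "cstar_algebra complex_cstar"
proof -
  interpret C: cring complex_ring
    by unfold_locales
      (auto simp: complex_ring_def algebra_simps Units_def intro!: exI[of _ "- _"])
  interpret R: ring complex_cstar
    by unfold_locales
      (auto simp: complex_cstar_def algebra_simps Units_def intro!: exI[of _ "- _"])
  have minus: "x \<ominus>\<^bsub>complex_cstar\<^esub> y = x - y" for x y
  proof -
    have "\<ominus>\<^bsub>complex_cstar\<^esub> y = - y"
      by (rule R.minus_equality) (auto simp: complex_cstar_def)
    then show ?thesis by (simp add: a_minus_def complex_cstar_def)
  qed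
  have M: "module complex_ring complex_cstar"
    by (intro moduleI C.cring_axioms R.abelian_group_axioms)
      (auto simp: complex_cstar_def complex_ring_def algebra_simps)
  show ?thesis
  proof (intro cstar_algebra.intro cstar_algebra_axioms.intro R.ring_axioms M, goal_cases)
    case (14 f)
    then have "Cauchy f"
      by (intro CauchyI) (simp add: minus, simp add: complex_cstar_def)
    then obtain a where "f \<longlonglongrightarrow> a" using Cauchy_convergent_iff convergent_def by blast
    then have "(\<lambda>n. cmod (f n - a)) \<longlonglongrightarrow> 0"
      using LIM_zero tendsto_norm_zero by blast
    then show ?case
      by (intro bexI[of _ a]) (simp_all add: minus, simp_all add: complex_cstar_def)
  qed (auto simp: complex_cstar_def algebra_simps norm_mult norm_triangle_ineq power2_eq_square)
qed

definition opp :: "'a cstar \<Rightarrow> 'a cstar" where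
  "opp A = A\<lparr>mult := (\<lambda>x y. y \<otimes>\<^bsub>A\<^esub> x)\<rparr>"

definition linear_maps :: "'a cstar \<Rightarrow> 'b cstar \<Rightarrow> ('a \<Rightarrow> 'b) set" where
  "linear_maps A B = {f \<in> carrier A \<rightarrow> carrier B.
     (\<forall>x\<in>carrier A. \<forall>y\<in>carrier A. f (x \<oplus>\<^bsub>A\<^esub> y) = f x \<oplus>\<^bsub>B\<^esub> f y) \<and>
     (\<forall>c. \<forall>x\<in>carrier A. f (c \<odot>\<^bsub>A\<^esub> x) = c \<odot>\<^bsub>B\<^esub> f x)}"

definition cstar_hom :: "'a cstar \<Rightarrow> 'b cstar \<Rightarrow> ('a \<Rightarrow> 'b) set" where
  "cstar_hom A B = {f \<in> linear_maps A B.
     (\<forall>x\<in>carrier A. \<forall>y\<in>carrier A. f (x \<otimes>\<^bsub>A\<^esub> y) = f x \<otimes>\<^bsub>B\<^esub> f y) \<and>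
     f \<one>\<^bsub>A\<^esub> = \<one>\<^bsub>B\<^esub> \<and>
     (\<forall>x\<in>carrier A. f (adj A x) = adj B (f x))}"

definition norm_closed :: "'a cstar \<Rightarrow> 'a set \<Rightarrow> bool" where
  "norm_closed A K \<longleftrightarrow> (\<forall>f a. (\<forall>n::nat. f n \<in> K) \<and> a \<in> carrier A \<and>
     (\<lambda>n. cnorm A (f n \<ominus>\<^bsub>A\<^esub> a)) \<longlonglongrightarrow> 0 \<longrightarrow> a \<in> K)"

definition cstar_subalgebra :: "'a cstar \<Rightarrow> 'a set \<Rightarrow> bool" where
  "cstar_subalgebra A K \<longleftrightarrow> K \<subseteq> carrier A \<and> \<one>\<^bsub>A\<^esub> \<in> K \<and>
     (\<forall>x\<in>K. \<forall>y\<in>K. x \<oplus>\<^bsub>A\<^esub> y \<in> K \<and> x \<otimes>\<^bsub>A\<^esub> y \<in> K) \<and>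
     (\<forall>c. \<forall>x\<in>K. c \<odot>\<^bsub>A\<^esub> x \<in> K) \<and> (\<forall>x\<in>K. adj A x \<in> K) \<and> norm_closed A K"

definition generates :: "'a cstar \<Rightarrow> 'a set \<Rightarrow> bool" where
  "generates A X \<longleftrightarrow> X \<subseteq> carrier A \<and> (\<forall>K. cstar_subalgebra A K \<and> X \<subseteq> K \<longrightarrow> K = carrier A)"


section \<open>Tensor products\<close>

definition multilinear :: "'r set \<Rightarrow> ('r \<Rightarrow> 'a cstar) \<Rightarrow> 'b cstar \<Rightarrow> (('r \<Rightarrow> 'a) \<Rightarrow> 'b) \<Rightarrow> bool" where
  "multilinear R A B f \<longleftrightarrow> f \<in> (\<Pi>\<^sub>E r\<in>R. carrier (A r)) \<rightarrow> carrier B \<and>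
     (\<forall>a\<in>\<Pi>\<^sub>E r\<in>R. carrier (A r). \<forall>r\<in>R. (\<lambda>y. f (a(r := y))) \<in> linear_maps (A r) B)"

text \<open>\<open>T\<close>, with \<open>\<tau> a\<close> playing the role of the elementary tensor of the family \<open>a\<close>, is a
  C*-algebraic tensor product of the \<open>A r\<close>, that is, a completion of their algebraic tensor product
  with respect to some C*-norm; no particular norm (minimal, maximal, ...) is singled out.
  The conjunct on multilinear forms is the universal property saying that the linear span of the
  elementary tensors is the algebraic tensor product (a linear form on a subspace extends to the
  whole space, and multilinear forms separate the points of an algebraic tensor product).
  That span being a *-subalgebra, the last conjunct says that it is dense.\<close>

definition cstar_tensor_product ::
    "'r set \<Rightarrow> ('r \<Rightarrow> 'a cstar) \<Rightarrow> 't cstar \<Rightarrow> (('r \<Rightarrow> 'a) \<Rightarrow> 't) \<Rightarrow> bool" where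
  "cstar_tensor_product R A T \<tau> \<longleftrightarrow>
     cstar_algebra T \<and> multilinear R A T \<tau> \<and>
     (\<forall>a\<in>\<Pi>\<^sub>E r\<in>R. carrier (A r). \<forall>b\<in>\<Pi>\<^sub>E r\<in>R. carrier (A r).
        \<tau> a \<otimes>\<^bsub>T\<^esub> \<tau> b = \<tau> (\<lambda>r\<in>R. a r \<otimes>\<^bsub>A r\<^esub> b r)) \<and>
     \<tau> (\<lambda>r\<in>R. \<one>\<^bsub>A r\<^esub>) = \<one>\<^bsub>T\<^esub> \<and>
     (\<forall>f. multilinear R A complex_cstar f \<longrightarrow>
        (\<exists>g\<in>linear_maps T complex_cstar. \<forall>a\<in>\<Pi>\<^sub>E r\<in>R. carrier (A r). g (\<tau> a) = f a)) \<and>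
     (\<forall>a\<in>\<Pi>\<^sub>E r\<in>R. carrier (A r). adj T (\<tau> a) = \<tau> (\<lambda>r\<in>R. adj (A r) (a r))) \<and>
     generates T (\<tau> ` (\<Pi>\<^sub>E r\<in>R. carrier (A r)))"

abbreviation pair_family :: "'a \<Rightarrow> 'a \<Rightarrow> nat \<Rightarrow> 'a" where
  "pair_family a b \<equiv> \<lambda>r\<in>{1, 2}. if r = 1 then a else b"


section \<open>Matrices over a C*-algebra, compact quantum groups\<close>

definition matrix_product ::
    "'a cstar \<Rightarrow> nat \<Rightarrow> (nat \<Rightarrow> nat \<Rightarrow> 'a) \<Rightarrow> (nat \<Rightarrow> nat \<Rightarrow> 'a) \<Rightarrow> nat \<Rightarrow> nat \<Rightarrow> 'a" where
  "matrix_product A N v w i j = (\<Oplus>\<^bsub>A\<^esub>k\<in>{1..N}. v i k \<otimes>\<^bsub>A\<^esub> w k j)"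

definition inverse_matrices ::
    "'a cstar \<Rightarrow> nat \<Rightarrow> (nat \<Rightarrow> nat \<Rightarrow> 'a) \<Rightarrow> (nat \<Rightarrow> nat \<Rightarrow> 'a) \<Rightarrow> bool" where
  "inverse_matrices A N v w \<longleftrightarrow> (\<forall>i\<in>{1..N}. \<forall>j\<in>{1..N}.
     matrix_product A N v w i j = (if i = j then \<one>\<^bsub>A\<^esub> else \<zero>\<^bsub>A\<^esub>) \<and>
     matrix_product A N w v i j = (if i = j then \<one>\<^bsub>A\<^esub> else \<zero>\<^bsub>A\<^esub>))"

definition conj_matrix :: "'a cstar \<Rightarrow> (nat \<Rightarrow> nat \<Rightarrow> 'a) \<Rightarrow> nat \<Rightarrow> nat \<Rightarrow> 'a" where
  "conj_matrix A v i j = adj A (v i j)"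

definition transpose_matrix :: "(nat \<Rightarrow> nat \<Rightarrow> 'a) \<Rightarrow> nat \<Rightarrow> nat \<Rightarrow> 'a" where
  "transpose_matrix v i j = v j i"

definition unitary_matrix :: "'a cstar \<Rightarrow> nat \<Rightarrow> (nat \<Rightarrow> nat \<Rightarrow> 'a) \<Rightarrow> bool" where
  "unitary_matrix A N v \<longleftrightarrow> inverse_matrices A N v (transpose_matrix (conj_matrix A v))"

definition biunitary_matrix :: "'a cstar \<Rightarrow> nat \<Rightarrow> (nat \<Rightarrow> nat \<Rightarrow> 'a) \<Rightarrow> bool" where
  "biunitary_matrix A N v \<longleftrightarrow>
     unitary_matrix A N v \<and> inverse_matrices A N (conj_matrix A v) (transpose_matrix v)"

text \<open>The universal C*-algebra of the free unitary quantum group and, below, that of the free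
  complex sphere are characterized by their universal properties (the morphism is
  unique because the coordinates generate). It suffices to test these on C*-algebras whose elements
  are real numbers: a C*-algebra generated by finitely many elements is separable, hence has at
  most continuum many elements, so that it is isomorphic to one whose carrier is a set of reals.
  The same remark applies to the tensor square of a finitely generated C*-algebra.\<close>

definition free_unitary :: "nat \<Rightarrow> 'a cstar \<Rightarrow> (nat \<Rightarrow> nat \<Rightarrow> 'a) \<Rightarrow> bool" where
  "free_unitary N A v \<longleftrightarrow>
     cstar_algebra A \<and> generates A {v i j | i j. i \<in> {1..N} \<and> j \<in> {1..N}} \<and> biunitary_matrix A N v \<and>
     (\<forall>(B :: real cstar) w. cstar_algebra B \<and> (\<forall>i\<in>{1..N}. \<forall>j\<in>{1..N}. w i j \<in> carrier B) \<and>
        biunitary_matrix B N w \<longrightarrow>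
        (\<exists>f\<in>cstar_hom A B. \<forall>i\<in>{1..N}. \<forall>j\<in>{1..N}. f (v i j) = w i j))"

definition hopf_cstar_algebra :: "nat \<Rightarrow> 'a cstar \<Rightarrow> (nat \<Rightarrow> nat \<Rightarrow> 'a) \<Rightarrow> bool" where
  "hopf_cstar_algebra N A u \<longleftrightarrow>
     cstar_algebra A \<and> generates A {u i j | i j. i \<in> {1..N} \<and> j \<in> {1..N}} \<and> unitary_matrix A N u \<and>
     (\<exists>(T :: real cstar) \<tau>. cstar_tensor_product {1, 2} (\<lambda>_. A) T \<tau> \<and>
        (\<exists>\<Delta>\<in>cstar_hom A T. \<forall>i\<in>{1..N}. \<forall>j\<in>{1..N}.
           \<Delta> (u i j) = (\<Oplus>\<^bsub>T\<^esub>k\<in>{1..N}. \<tau> (pair_family (u i k) (u k j))))) \<and>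
     (\<exists>\<epsilon>\<in>cstar_hom A complex_cstar. \<forall>i\<in>{1..N}. \<forall>j\<in>{1..N}. \<epsilon> (u i j) = (if i = j then 1 else 0)) \<and>
     (\<exists>S\<in>cstar_hom A (opp A). \<forall>i\<in>{1..N}. \<forall>j\<in>{1..N}. S (u i j) = adj A (u j i))"

definition closed_quantum_subgroup :: "nat \<Rightarrow> 'a cstar \<Rightarrow> (nat \<Rightarrow> nat \<Rightarrow> 'a) \<Rightarrow> bool" where
  "closed_quantum_subgroup N A u \<longleftrightarrow> hopf_cstar_algebra N A u \<and>
     (\<exists>(B :: real cstar) v. free_unitary N B v \<and>
        (\<exists>f\<in>cstar_hom B A. \<forall>i\<in>{1..N}. \<forall>j\<in>{1..N}. f (v i j) = u i j))"


section \<open>Colored integers and intertwiners\<close>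

datatype color = White | Black

fun color_power :: "'a cstar \<Rightarrow> color \<Rightarrow> 'a \<Rightarrow> 'a" where
  "color_power A White x = x"
| "color_power A Black x = adj A x"

definition color_word :: "'a cstar \<Rightarrow> color list \<Rightarrow> 'a list \<Rightarrow> 'a" where
  "color_word A e xs = foldr (mult A) (map2 (color_power A) e xs) \<one>\<^bsub>A\<^esub>"

definition tuples :: "'i set \<Rightarrow> nat \<Rightarrow> 'i list set" where
  "tuples X k = {is. set is \<subseteq> X \<and> length is = k}"

definition tensor_power ::
    "'a cstar \<Rightarrow> ('i \<Rightarrow> 'i \<Rightarrow> 'a) \<Rightarrow> color list \<Rightarrow> 'i list \<Rightarrow> 'i list \<Rightarrow> 'a" where
  "tensor_power A u e is js = color_word A e (map2 u is js)"

text \<open>Vectors and matrices indexed by tuples are functions vanishing outside the index set; the row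
  (output) index of a matrix comes first.\<close>

definition Hom_space ::
    "'i set \<Rightarrow> 'a cstar \<Rightarrow> ('i \<Rightarrow> 'i \<Rightarrow> 'a) \<Rightarrow> color list \<Rightarrow> color list \<Rightarrow>
     ('i list \<Rightarrow> 'i list \<Rightarrow> complex) set" where
  "Hom_space X A u k l = {T.
     (\<forall>js is. T js is \<noteq> 0 \<longrightarrow> js \<in> tuples X (length l) \<and> is \<in> tuples X (length k)) \<and>
     (\<forall>js\<in>tuples X (length l). \<forall>is\<in>tuples X (length k).
        (\<Oplus>\<^bsub>A\<^esub>as\<in>tuples X (length k). T js as \<odot>\<^bsub>A\<^esub> tensor_power A u k as is) =
        (\<Oplus>\<^bsub>A\<^esub>bs\<in>tuples X (length l). T bs is \<odot>\<^bsub>A\<^esub> tensor_power A u l js bs))}"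

definition Fix_space ::
    "'i set \<Rightarrow> 'a cstar \<Rightarrow> ('i \<Rightarrow> 'i \<Rightarrow> 'a) \<Rightarrow> color list \<Rightarrow> ('i list \<Rightarrow> complex) set" where
  "Fix_space X A u k = {\<xi>.
     (\<forall>is. \<xi> is \<noteq> 0 \<longrightarrow> is \<in> tuples X (length k)) \<and>
     (\<forall>is\<in>tuples X (length k).
        (\<Oplus>\<^bsub>A\<^esub>js\<in>tuples X (length k). \<xi> js \<odot>\<^bsub>A\<^esub> tensor_power A u k is js) = \<xi> is \<odot>\<^bsub>A\<^esub> \<one>\<^bsub>A\<^esub>)}"


section \<open>Partitions and easiness\<close>

text \<open>The upper legs of a partition are \<open>Inl p\<close> with \<open>p < k\<close>, the lower ones \<open>Inr q\<close> with \<open>q < l\<close>.\<close>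

type_synonym legs_partition = "(nat + nat) set set"

definition partitions :: "nat \<Rightarrow> nat \<Rightarrow> legs_partition set" where
  "partitions k l = {\<pi>. partition_on ({..<k} <+> {..<l}) \<pi>}"

definition coarsens :: "'p set set \<Rightarrow> 'p set set \<Rightarrow> bool" where
  "coarsens \<sigma> \<pi> \<longleftrightarrow> (\<forall>B\<in>\<pi>. \<exists>C\<in>\<sigma>. B \<subseteq> C)"

definition superposition :: "'p set \<Rightarrow> 'p set set set \<Rightarrow> 'p set set" where
  "superposition X P = (THE \<sigma>. partition_on X \<sigma> \<and> (\<forall>\<pi>\<in>P. coarsens \<sigma> \<pi>) \<and>
     (\<forall>\<rho>. partition_on X \<rho> \<and> (\<forall>\<pi>\<in>P. coarsens \<rho> \<pi>) \<longrightarrow> refines X \<sigma> \<rho>))"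

lemma ex1_superposition:
  assumes "\<And>\<pi> B. \<pi> \<in> P \<Longrightarrow> B \<in> \<pi> \<Longrightarrow> B \<subseteq> X \<and> B \<noteq> {}"
  shows "\<exists>!\<sigma>. partition_on X \<sigma> \<and> (\<forall>\<pi>\<in>P. coarsens \<sigma> \<pi>) \<and>
     (\<forall>\<rho>. partition_on X \<rho> \<and> (\<forall>\<pi>\<in>P. coarsens \<rho> \<pi>) \<longrightarrow> refines X \<sigma> \<rho>)"
proof -
  define s where "s = (\<Union>\<pi>\<in>P. \<Union>B\<in>\<pi>. B \<times> B)"
  define r where "r = X \<times> X \<inter> s\<^sup>*"
  have "sym s" by (auto simp: s_def sym_def)
  then have "sym (s\<^sup>*)" by (rule sym_rtrancl)
  then have r: "equiv X r"
    unfolding r_def by (auto intro!: equivI simp: refl_on_def sym_def trans_def)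
  then have part: "partition_on X (X // r)"
    by (rule partition_on_quotient)
  have coarse: "coarsens (X // r) \<pi>" if p: "\<pi> \<in> P" for \<pi>
    unfolding coarsens_def
  proof
    fix B assume B: "B \<in> \<pi>"
    then obtain b where b: "b \<in> B" using assms p by blast
    have "B \<subseteq> r `` {b}"
      using assms[OF p B] b B p by (auto simp: r_def s_def)
    moreover have "r `` {b} \<in> X // r"
      using assms[OF p B] b by (auto simp: quotient_def)
    ultimately show "\<exists>C\<in>X // r. B \<subseteq> C" by blast
  qed
  have least: "refines X (X // r) \<rho>" if \<rho>: "partition_on X \<rho>" "\<forall>\<pi>\<in>P. coarsens \<rho> \<pi>" for \<rho>
    unfolding refines_def
  proof (intro conjI ballI part \<rho>(1))
    fix Y assume "Y \<in> X // r"
    then obtain x where x: "x \<in> X" "Y = r `` {x}" by (auto simp: quotient_def)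
    then obtain C where C: "C \<in> \<rho>" "x \<in> C" using partition_onD1[OF \<rho>(1)] by blast
    have "y \<in> C" if "(x, y) \<in> s\<^sup>*" for y
      using that
    proof (induction rule: rtrancl_induct)
      case (step y z)
      then obtain \<pi> B where "\<pi> \<in> P" "B \<in> \<pi>" "y \<in> B" "z \<in> B" by (auto simp: s_def)
      with \<rho>(2) obtain C' where C': "C' \<in> \<rho>" "B \<subseteq> C'"
        unfolding coarsens_def by blast
      then have "C' = C"
        using partition_onD2[OF \<rho>(1)] C(1) step.IH \<open>y \<in> B\<close> by (auto simp: disjoint_def)
      then show ?case using C' \<open>z \<in> B\<close> by blast
    qed (use C in auto)
    then show "\<exists>Z\<in>\<rho>. Y \<subseteq> Z" using x C by (auto simp: r_def)
  qed
  show ?thesis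
  proof (rule ex1I[of _ "X // r"], intro conjI allI impI ballI)
    fix \<sigma>
    assume "partition_on X \<sigma> \<and> (\<forall>\<pi>\<in>P. coarsens \<sigma> \<pi>) \<and>
      (\<forall>\<rho>. partition_on X \<rho> \<and> (\<forall>\<pi>\<in>P. coarsens \<rho> \<pi>) \<longrightarrow> refines X \<sigma> \<rho>)"
    then have "refines X \<sigma> (X // r)" "refines X (X // r) \<sigma>"
      using part coarse least by blast+
    then show "\<sigma> = X // r" by (rule refines_asym)
  qed (use part coarse least in auto)
qed

text \<open>For \<open>vertical_concat\<close>, \<open>\<pi>\<close> (with \<open>k\<close> upper and \<open>l\<close> lower legs) is put on top of \<open>\<sigma>\<close> (with
  \<open>l\<close> upper and \<open>m\<close> lower legs): upper, middle and lower legs are \<open>Inl p\<close>, \<open>Inr (Inl q)\<close> and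
  \<open>Inr (Inr r)\<close>. After superposition the middle legs, and the blocks consisting only of such legs,
  are removed.\<close>

definition vertical_concat ::
    "nat \<Rightarrow> nat \<Rightarrow> nat \<Rightarrow> legs_partition \<Rightarrow> legs_partition \<Rightarrow> legs_partition" where
  "vertical_concat k l m \<pi> \<sigma> =
     (\<lambda>B. map_sum id Inr -` B) `
       superposition ({..<k} <+> ({..<l} <+> {..<m})) {(`) (map_sum id Inl) ` \<pi>, (`) Inr ` \<sigma>} - {{}}"

definition horizontal_concat :: "nat \<Rightarrow> nat \<Rightarrow> legs_partition \<Rightarrow> legs_partition \<Rightarrow> legs_partition" where
  "horizontal_concat k l \<pi> \<sigma> = \<pi> \<union> (`) (map_sum (\<lambda>p. k + p) (\<lambda>q. l + q)) ` \<sigma>"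

definition upside_down :: "legs_partition \<Rightarrow> legs_partition" where
  "upside_down \<pi> = (`) (case_sum Inr Inl) ` \<pi>"

definition category_of_partitions :: "(color list \<Rightarrow> color list \<Rightarrow> legs_partition set) \<Rightarrow> bool" where
  "category_of_partitions D \<longleftrightarrow>
     (\<forall>k l. D k l \<subseteq> partitions (length k) (length l)) \<and>
     (\<forall>k l m. \<forall>\<pi>\<in>D k l. \<forall>\<sigma>\<in>D l m.
        vertical_concat (length k) (length l) (length m) \<pi> \<sigma> \<in> D k m) \<and>
     (\<forall>k l k' l'. \<forall>\<pi>\<in>D k l. \<forall>\<sigma>\<in>D k' l'.
        horizontal_concat (length k) (length l) \<pi> \<sigma> \<in> D (k @ k') (l @ l')) \<and>
     (\<forall>k l. \<forall>\<pi>\<in>D k l. upside_down \<pi> \<in> D l k)"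

definition partition_delta :: "legs_partition \<Rightarrow> 'i list \<Rightarrow> 'i list \<Rightarrow> complex" where
  "partition_delta \<pi> is js =
     of_bool (\<forall>B\<in>\<pi>. \<forall>p\<in>B. \<forall>q\<in>B. case_sum (nth is) (nth js) p = case_sum (nth is) (nth js) q)"

definition partition_map ::
    "'i set \<Rightarrow> nat \<Rightarrow> nat \<Rightarrow> legs_partition \<Rightarrow> 'i list \<Rightarrow> 'i list \<Rightarrow> complex" where
  "partition_map X k l \<pi> js is =
     (if js \<in> tuples X l \<and> is \<in> tuples X k then partition_delta \<pi> is js else 0)"

definition easy_quantum_group ::
    "nat \<Rightarrow> 'a cstar \<Rightarrow> (nat \<Rightarrow> nat \<Rightarrow> 'a) \<Rightarrow> (color list \<Rightarrow> color list \<Rightarrow> legs_partition set) \<Rightarrow> bool" where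
  "easy_quantum_group N A u D \<longleftrightarrow>
     closed_quantum_subgroup N A u \<and> category_of_partitions D \<and>
     (\<forall>k l. Hom_space {1..N} A u k l =
        {T. \<exists>c. T = (\<lambda>js is. \<Sum>\<pi>\<in>D k l. c \<pi> * partition_map {1..N} (length k) (length l) \<pi> js is)})"


section \<open>Products, spheres and the spaces X\<close>

definition multi_indices :: "nat \<Rightarrow> (nat \<Rightarrow> nat) \<Rightarrow> (nat \<Rightarrow> nat) set" where
  "multi_indices s N = (\<Pi>\<^sub>E r\<in>{1..s}. {1..N r})"

definition product_coords ::
    "nat \<Rightarrow> (nat \<Rightarrow> nat \<Rightarrow> nat \<Rightarrow> 'a) \<Rightarrow> ((nat \<Rightarrow> 'a) \<Rightarrow> 't) \<Rightarrow> (nat \<Rightarrow> nat) \<Rightarrow> (nat \<Rightarrow> nat) \<Rightarrow> 't" where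
  "product_coords s u \<tau> i j = \<tau> (\<lambda>r\<in>{1..s}. u r (i r) (j r))"

definition diagonal_indices :: "nat \<Rightarrow> nat set \<Rightarrow> (nat \<Rightarrow> nat) set" where
  "diagonal_indices s J = (\<lambda>c. \<lambda>r\<in>{1..s}. c) ` J"

definition sphere_relations :: "'i set \<Rightarrow> 'a cstar \<Rightarrow> ('i \<Rightarrow> 'a) \<Rightarrow> bool" where
  "sphere_relations X A x \<longleftrightarrow>
     (\<Oplus>\<^bsub>A\<^esub>i\<in>X. x i \<otimes>\<^bsub>A\<^esub> adj A (x i)) = \<one>\<^bsub>A\<^esub> \<and> (\<Oplus>\<^bsub>A\<^esub>i\<in>X. adj A (x i) \<otimes>\<^bsub>A\<^esub> x i) = \<one>\<^bsub>A\<^esub>"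

definition free_sphere :: "'i set \<Rightarrow> 'a cstar \<Rightarrow> ('i \<Rightarrow> 'a) \<Rightarrow> bool" where
  "free_sphere X A x \<longleftrightarrow>
     cstar_algebra A \<and> generates A (x ` X) \<and> sphere_relations X A x \<and>
     (\<forall>(B :: real cstar) y. cstar_algebra B \<and> (\<forall>i\<in>X. y i \<in> carrier B) \<and> sphere_relations X B y \<longrightarrow>
        (\<exists>f\<in>cstar_hom A B. \<forall>i\<in>X. f (x i) = y i))"

text \<open>Closed two-sided ideals of a C*-algebra are automatically self-adjoint; this is included so
  that the involution of the quotient is visibly well defined.\<close>

definition closed_ideal_generated :: "'a cstar \<Rightarrow> 'a set \<Rightarrow> 'a set" where
  "closed_ideal_generated A E =
     \<Inter>{K. ideal K A \<and> (\<forall>c. \<forall>x\<in>K. c \<odot>\<^bsub>A\<^esub> x \<in> K) \<and> (\<forall>x\<in>K. adj A x \<in> K) \<and> norm_closed A K \<and> E \<subseteq> K}"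

definition cstar_quotient :: "'a cstar \<Rightarrow> 'a set \<Rightarrow> 'a set cstar" where
  "cstar_quotient A K = \<lparr>carrier = a_rcosets\<^bsub>A\<^esub> K, mult = rcoset_mult A K,
     one = K +>\<^bsub>A\<^esub> \<one>\<^bsub>A\<^esub>, zero = K, add = set_add A,
     smult = (\<lambda>c Y. \<Union>y\<in>Y. K +>\<^bsub>A\<^esub> (c \<odot>\<^bsub>A\<^esub> y)), adj = (\<lambda>Y. \<Union>y\<in>Y. K +>\<^bsub>A\<^esub> adj A y),
     cnorm = (\<lambda>Y. INF y\<in>Y. cnorm A y)\<rparr>"

text \<open>A relation \<open>a = b\<close> is encoded as the pair \<open>(a, b)\<close>.\<close>

definition quotient_by_relations :: "'a cstar \<Rightarrow> ('a \<times> 'a) set \<Rightarrow> 'a set cstar" where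
  "quotient_by_relations A E =
     cstar_quotient A (closed_ideal_generated A ((\<lambda>(a, b). a \<ominus>\<^bsub>A\<^esub> b) ` E))"

text \<open>\<open>C_X X S x A u I\<close> is C(X_{G,I}), where \<open>X\<close> is the set of indices, \<open>S\<close> with coordinates \<open>x\<close> is
  the algebra of the free sphere, and \<open>A\<close> with coordinates \<open>u\<close> is C(G).\<close>

definition C_X ::
    "'i set \<Rightarrow> 'b cstar \<Rightarrow> ('i \<Rightarrow> 'b) \<Rightarrow> 'a cstar \<Rightarrow> ('i \<Rightarrow> 'i \<Rightarrow> 'a) \<Rightarrow> 'i set \<Rightarrow> 'b set cstar" where
  "C_X X S x A u I = quotient_by_relations S
     {(\<Oplus>\<^bsub>S\<^esub>as\<in>tuples X (length e). \<xi> as \<odot>\<^bsub>S\<^esub> color_word S e (map x as),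
       (complex_of_real (1 / sqrt (real (card I) ^ length e)) * (\<Sum>bs\<in>tuples I (length e). \<xi> bs))
         \<odot>\<^bsub>S\<^esub> \<one>\<^bsub>S\<^esub>)
      | e \<xi>. \<xi> \<in> Fix_space X A u e}"

text \<open>A vector of multi-indices is a list of functions; its \<open>r\<close>-th component is \<open>map (\<lambda>i. i r) is\<close>.
  Partitions in \<open>P(k) = P(0,k)\<close> have lower legs only.\<close>

definition multi_delta :: "nat \<Rightarrow> (nat \<Rightarrow> legs_partition) \<Rightarrow> (nat \<Rightarrow> nat) list \<Rightarrow> complex" where
  "multi_delta s \<pi> is = (\<Prod>r\<in>{1..s}. partition_delta (\<pi> r) [] (map (\<lambda>i. i r) is))"

definition superposed :: "nat \<Rightarrow> nat \<Rightarrow> (nat \<Rightarrow> legs_partition) \<Rightarrow> legs_partition" where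
  "superposed s k \<pi> = superposition ({..<0} <+> {..<k}) (\<pi> ` {1..s})"

end

theory Submission
  imports Defs
begin

text \<open>
  Both quotients are taken by closed ideals, so it suffices that each family of relations lies in
  the ideal generated by the other. A relation attached to a fixed vector \<open>\<xi>\<close> depends linearly on
  \<open>\<xi>\<close>, on both of its sides. The theorem therefore reduces to two facts.

  The first fact is that the fixed vectors of the product are spanned by the vectors
  \<open>\<delta>_\<pi>\<close>, \<open>\<pi> \<in> D_1(k) \<times> ... \<times> D_s(k)\<close>; in other words,
  \<open>Fix(u^k)\<close> is the tensor product of the spaces \<open>Fix(u_r^k)\<close>, each spanned by partitions because
  the factors are easy. That tensors of fixed vectors are fixed is multilinearity
  (\<open>tensor_product_in_Fix_space\<close>). Conversely, let \<open>\<xi>\<close> be fixed and apply to the equation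
  \<open>u^k \<xi> = \<xi>\<close> the linear form that is an arbitrary \<open>\<phi>\<close> on the \<open>q\<close>-th factor
  and the counit on the others. The counits turn the other matrices into identities, so
  what remains is the statement, tested by \<open>\<phi>\<close>, that each slice of \<open>\<xi>\<close> in the
  \<open>q\<close>-th direction is fixed by the \<open>q\<close>-th factor (\<open>slice_in_Fix_space\<close>). A vector all of
  whose slices lie in given finite-dimensional spaces lies in their tensor product: apply a projection onto
  each of these spaces, one direction after the other (\<open>ex_tensor_expansion\<close>).

  The argument needs every linear form on a factor to extend to the product, which is part of the
  universal property of the algebraic tensor product, and linear forms to separate points
  (\<open>eq_if_linear_forms_eq\<close>). The latter also
  serves as a general device: identities between finite sums in an algebra are tested by linear forms and
  become identities between sums of complex numbers.

  The second fact is the value of the right-hand side on \<open>\<delta>_\<pi>\<close>. A tuple of diagonal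
  indices is a tuple of elements of \<open>J\<close>, and \<open>\<delta>_\<pi>\<close> is 1 on it exactly when it is constant
  on the blocks of every \<open>\<pi>_r\<close>, that is, on the blocks of their superposition. There are
  \<open>|J|\<close> to the power \<open>|\<pi>_1 \<or> ... \<or> \<pi>_s|\<close> such tuples (\<open>diagonal_evaluation\<close>).
\<close>

section \<open>Linear forms\<close>

abbreviation linear_forms :: "'a cstar \<Rightarrow> ('a \<Rightarrow> complex) set" where
  "linear_forms A \<equiv> linear_maps A complex_cstar"

lemma linear_formD:
  assumes "\<phi> \<in> linear_forms A"
  shows linear_form_add: "x \<in> carrier A \<Longrightarrow> y \<in> carrier A \<Longrightarrow> \<phi> (x \<oplus>\<^bsub>A\<^esub> y) = \<phi> x + \<phi> y"
    and linear_form_scale: "x \<in> carrier A \<Longrightarrow> \<phi> (c \<odot>\<^bsub>A\<^esub> x) = c * \<phi> x"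
  using assms by (auto simp: linear_maps_def complex_cstar_def)

lemma linear_formI:
  assumes "\<And>x y. x \<in> carrier A \<Longrightarrow> y \<in> carrier A \<Longrightarrow> \<phi> (x \<oplus>\<^bsub>A\<^esub> y) = \<phi> x + \<phi> y"
    and "\<And>c x. x \<in> carrier A \<Longrightarrow> \<phi> (c \<odot>\<^bsub>A\<^esub> x) = c * \<phi> x"
  shows "\<phi> \<in> linear_forms A"
  using assms by (auto simp: linear_maps_def complex_cstar_def)

context cstar_algebra
begin

text \<open>The inherited facts on rings that carry no qualifier concern the scalars
  \<open>complex_ring\<close>; those on the addition of \<open>A\<close> get names of their own.\<close>

lemma ring_A: "ring A"
  using cstar_algebra_axioms by (rule cstar_algebra.axioms)

lemmas abelian_group_A = ring.is_abelian_group[OF ring_A]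
lemmas abelian_monoid_A = abelian_group.axioms(1)[OF abelian_group_A]
lemmas plus_ac = abelian_monoid.a_ac[OF abelian_monoid_A]
lemmas plus_assoc = abelian_monoid.a_assoc[OF abelian_monoid_A]
lemmas left_neg = abelian_group.l_neg[OF abelian_group_A]

lemma scale_closed [simp]: "x \<in> carrier A \<Longrightarrow> c \<odot> x \<in> carrier A"
  using smult_closed[of c x] by (simp add: complex_ring_def)

lemma scale_add_left: "x \<in> carrier A \<Longrightarrow> (c + d) \<odot> x = c \<odot> x \<oplus> d \<odot> x"
  using smult_l_distr[of c d x] by (simp add: complex_ring_def)

lemma scale_add_right:
  "x \<in> carrier A \<Longrightarrow> y \<in> carrier A \<Longrightarrow> c \<odot> (x \<oplus> y) = c \<odot> x \<oplus> c \<odot> y"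
  using smult_r_distr[of c x y] by (simp add: complex_ring_def)

lemma scale_scale: "x \<in> carrier A \<Longrightarrow> c \<odot> (d \<odot> x) = (c * d) \<odot> x"
  using smult_assoc1[of c d x] by (simp add: complex_ring_def)

lemma scale_one [simp]: "x \<in> carrier A \<Longrightarrow> 1 \<odot> x = x"
  using smult_one[of x] by (simp add: complex_ring_def)

lemma scale_zero [simp]: "x \<in> carrier A \<Longrightarrow> 0 \<odot> x = \<zero>"
  using smult_l_null[of x] by (simp add: complex_ring_def)

lemma scale_zero_right [simp]: "c \<odot> \<zero> = \<zero>"
  using smult_r_null[of c] by (simp add: complex_ring_def)

lemma linear_form_zero: "\<phi> \<in> linear_forms A \<Longrightarrow> \<phi> \<zero> = 0"
  using linear_form_scale[of \<phi> A \<zero> 0] by simp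

lemma linear_form_minus:
  assumes "\<phi> \<in> linear_forms A" "x \<in> carrier A" "y \<in> carrier A"
  shows "\<phi> (x \<ominus> y) = \<phi> x - \<phi> y"
proof -
  have "\<phi> (x \<ominus> y) + \<phi> y = \<phi> ((x \<ominus> y) \<oplus> y)"
    using assms by (simp add: linear_form_add)
  also have "(x \<ominus> y) \<oplus> y = x"
    using assms(2,3) by (simp add: a_minus_def plus_assoc left_neg)
  finally show ?thesis by (simp add: algebra_simps)
qed

lemma linear_form_finsum:
  assumes "\<phi> \<in> linear_forms A" "finite T" "\<And>t. t \<in> T \<Longrightarrow> f t \<in> carrier A"
  shows "\<phi> (\<Oplus>t\<in>T. f t) = (\<Sum>t\<in>T. \<phi> (f t))"
  using assms(2,3)
proof (induction T rule: finite_induct)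
  case (insert t T)
  then have "f \<in> T \<rightarrow> carrier A" "f t \<in> carrier A" by auto
  then show ?case
    using insert assms(1) by (simp add: linear_form_add)
qed (simp add: linear_form_zero[OF assms(1)])

lemma linear_form_combination:
  assumes "\<phi> \<in> linear_forms A" "finite T" "\<And>t. t \<in> T \<Longrightarrow> f t \<in> carrier A"
  shows "\<phi> (\<Oplus>t\<in>T. c t \<odot> f t) = (\<Sum>t\<in>T. c t * \<phi> (f t))"
  using assms by (simp add: linear_form_finsum linear_form_scale)

definition linear_subspace :: "'a set \<Rightarrow> bool" where
  "linear_subspace K \<longleftrightarrow> K \<subseteq> carrier A \<and> \<zero> \<in> K \<and> (\<forall>x\<in>K. \<forall>y\<in>K. x \<oplus> y \<in> K) \<and> (\<forall>c. \<forall>x\<in>K. c \<odot> x \<in> K)"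

lemma linear_subspaceD:
  assumes "linear_subspace K"
  shows "x \<in> K \<Longrightarrow> x \<in> carrier A" "\<zero> \<in> K" "x \<in> K \<Longrightarrow> y \<in> K \<Longrightarrow> x \<oplus> y \<in> K"
    "x \<in> K \<Longrightarrow> c \<odot> x \<in> K"
  using assms by (auto simp: linear_subspace_def)

text \<open>By Zorn's lemma there is a subspace \<open>H\<close> that is maximal among those not containing \<open>a\<close>.
  It is complementary to the line through \<open>a\<close>: if \<open>x \<notin> H\<close>, the span of \<open>H\<close> and \<open>x\<close> must
  contain \<open>a\<close>, so that \<open>x\<close> is a multiple of \<open>a\<close> modulo \<open>H\<close>. The coefficient of \<open>a\<close> is the
  linear form.\<close>

lemma ex_linear_form_nonzero:
  assumes a: "a \<in> carrier A" "a \<noteq> \<zero>"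
  shows "\<exists>\<phi>\<in>linear_forms A. \<phi> a \<noteq> 0"
proof -
  have "\<exists>H\<in>{K. linear_subspace K \<and> a \<notin> K}. \<forall>X\<in>{K. linear_subspace K \<and> a \<notin> K}. H \<subseteq> X \<longrightarrow> X = H"
  proof (rule subset_Zorn_nonempty)
    have "linear_subspace {\<zero>}" by (auto simp: linear_subspace_def)
    then show "{K. linear_subspace K \<and> a \<notin> K} \<noteq> {}" using a(2) by blast
  next
    fix \<C> assume C: "\<C> \<noteq> {}" "subset.chain {K. linear_subspace K \<and> a \<notin> K} \<C>"
    then have K: "\<And>K. K \<in> \<C> \<Longrightarrow> linear_subspace K" and nin: "\<And>K. K \<in> \<C> \<Longrightarrow> a \<notin> K"
      by (auto simp: subset.chain_def)
    have "x \<oplus> y \<in> \<Union>\<C>" if "x \<in> \<Union>\<C>" "y \<in> \<Union>\<C>" for x y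
    proof -
      obtain K L where KL: "K \<in> \<C>" "L \<in> \<C>" "x \<in> K" "y \<in> L"
        using \<open>x \<in> \<Union>\<C>\<close> \<open>y \<in> \<Union>\<C>\<close> by blast
      then have "K \<subseteq> L \<or> L \<subseteq> K" using subset.chain_total[OF C(2)] by blast
      then show ?thesis using linear_subspaceD(3)[OF K] KL by blast
    qed
    moreover have "\<zero> \<in> \<Union>\<C>" using C(1) linear_subspaceD(2)[OF K] by blast
    moreover have "\<Union>\<C> \<subseteq> carrier A" using linear_subspaceD(1)[OF K] by blast
    moreover have "c \<odot> x \<in> \<Union>\<C>" if "x \<in> \<Union>\<C>" for c x using that linear_subspaceD(4)[OF K] by blast
    ultimately show "\<Union>\<C> \<in> {K. linear_subspace K \<and> a \<notin> K}"
      using nin by (auto simp: linear_subspace_def)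
  qed
  then obtain H where H: "linear_subspace H" "a \<notin> H"
    and max: "\<And>X. linear_subspace X \<Longrightarrow> a \<notin> X \<Longrightarrow> H \<subseteq> X \<Longrightarrow> X = H" by blast
  note Hc = linear_subspaceD(1)[OF H(1)]
  have ex: "\<exists>c. \<exists>h\<in>H. x = h \<oplus> c \<odot> a" if x: "x \<in> carrier A" for x
  proof (cases "x \<in> H")
    case True
    then show ?thesis using a by (intro exI[of _ 0] bexI[of _ x]) (auto simp: x)
  next
    case False
    define X where "X = {h \<oplus> c \<odot> x | h c. h \<in> H}"
    have "linear_subspace X"
      unfolding linear_subspace_def
    proof (intro conjI ballI allI)
      show "X \<subseteq> carrier A" using x Hc by (auto simp: X_def)
      show "\<zero> \<in> X" unfolding X_def using x linear_subspaceD(2)[OF H(1)]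
        by (auto intro!: exI[of _ "\<zero>"] exI[of _ "0::complex"])
    next
      fix y z assume "y \<in> X" "z \<in> X"
      then obtain h k c d where *: "h \<in> H" "k \<in> H" "y = h \<oplus> c \<odot> x" "z = k \<oplus> d \<odot> x"
        unfolding X_def by blast
      then have "y \<oplus> z = (h \<oplus> k) \<oplus> (c + d) \<odot> x"
        using Hc x by (simp add: scale_add_left plus_ac)
      then show "y \<oplus> z \<in> X"
        unfolding X_def using linear_subspaceD(3)[OF H(1)] * by blast
    next
      fix c y assume "y \<in> X"
      then obtain h d where *: "h \<in> H" "y = h \<oplus> d \<odot> x" unfolding X_def by blast
      then have "c \<odot> y = c \<odot> h \<oplus> (c * d) \<odot> x"
        using Hc x by (simp add: scale_add_right scale_scale)
      then show "c \<odot> y \<in> X" unfolding X_def using linear_subspaceD(4)[OF H(1)] * by blast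
    qed
    moreover have "H \<subseteq> X"
    proof
      fix h assume "h \<in> H"
      then show "h \<in> X" unfolding X_def using Hc x
        by (auto intro!: exI[of _ h] exI[of _ "0::complex"])
    qed
    moreover have "x \<in> X" unfolding X_def using x linear_subspaceD(2)[OF H(1)]
      by (auto intro!: exI[of _ "\<zero>"] exI[of _ "1::complex"])
    ultimately have "a \<in> X" using max[of X] False by blast
    then obtain h c where hc: "h \<in> H" "a = h \<oplus> c \<odot> x" unfolding X_def by blast
    have "c \<noteq> 0" using hc H(2) Hc x by auto
    have "(- 1 / c) \<odot> h \<oplus> (1 / c) \<odot> a = ((- 1 / c) \<odot> h \<oplus> (1 / c) \<odot> h) \<oplus> x"
      using hc Hc x \<open>c \<noteq> 0\<close> by (simp add: scale_add_right scale_scale plus_assoc)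
    also have "(- 1 / c) \<odot> h \<oplus> (1 / c) \<odot> h = \<zero>"
      using hc Hc by (simp flip: scale_add_left)
    finally have "x = (- 1 / c) \<odot> h \<oplus> (1 / c) \<odot> a" using x by simp
    then show ?thesis using linear_subspaceD(4)[OF H(1) hc(1)] by blast
  qed
  have unique: "c = d" if eq: "h \<oplus> c \<odot> a = k \<oplus> d \<odot> a" and hk: "h \<in> H" "k \<in> H" for h k c d
  proof (rule ccontr)
    assume "c \<noteq> d"
    have hk': "h \<in> carrier A" "k \<in> carrier A" using hk Hc by auto
    have neg: "(- b) \<odot> x \<oplus> b \<odot> x = \<zero>" if "x \<in> carrier A" for b x
      using scale_add_left[OF that, of "- b" b] that by simp
    have "(c + - d) \<odot> a = ((- 1) \<odot> h \<oplus> 1 \<odot> h) \<oplus> (c + - d) \<odot> a"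
      unfolding neg[OF hk'(1)] using a by simp
    also have "\<dots> = (- 1) \<odot> h \<oplus> ((h \<oplus> c \<odot> a) \<oplus> (- d) \<odot> a)"
      unfolding scale_add_left[OF a(1)] using hk' a by (simp add: plus_assoc)
    also have "\<dots> = (- 1) \<odot> h \<oplus> (k \<oplus> (d \<odot> a \<oplus> (- d) \<odot> a))"
      unfolding eq using hk' a by (simp add: plus_assoc)
    also have "d \<odot> a \<oplus> (- d) \<odot> a = \<zero>"
      using neg[OF a(1), of "- d"] by simp
    finally have "(c + - d) \<odot> a = (- 1) \<odot> h \<oplus> k" using hk' by simp
    then have "(c + - d) \<odot> a \<in> H" using hk linear_subspaceD(3,4)[OF H(1)] by simp
    then have "(1 / (c + - d)) \<odot> ((c + - d) \<odot> a) \<in> H" by (rule linear_subspaceD(4)[OF H(1)])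
    then show False using \<open>c \<noteq> d\<close> H(2) a by (simp add: scale_scale)
  qed
  define \<phi> where "\<phi> x = (THE c. \<exists>h\<in>H. x = h \<oplus> c \<odot> a)" for x
  have \<phi>: "\<phi> (h \<oplus> c \<odot> a) = c" if "h \<in> H" for h c
    unfolding \<phi>_def using that unique by blast
  have "\<phi> \<in> linear_forms A"
  proof (rule linear_formI)
    fix x y assume "x \<in> carrier A" "y \<in> carrier A"
    then obtain h k c d where *: "h \<in> H" "k \<in> H" "x = h \<oplus> c \<odot> a" "y = k \<oplus> d \<odot> a"
      using ex by meson
    then have "x \<oplus> y = (h \<oplus> k) \<oplus> (c + d) \<odot> a"
      using Hc a by (simp add: scale_add_left plus_ac)
    then show "\<phi> (x \<oplus> y) = \<phi> x + \<phi> y"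
      using \<phi> * linear_subspaceD(3)[OF H(1)] by simp
  next
    fix c x assume "x \<in> carrier A"
    then obtain h d where *: "h \<in> H" "x = h \<oplus> d \<odot> a" using ex by meson
    then have "c \<odot> x = c \<odot> h \<oplus> (c * d) \<odot> a"
      using Hc a by (simp add: scale_add_right scale_scale)
    then show "\<phi> (c \<odot> x) = c * \<phi> x" using \<phi> * linear_subspaceD(4)[OF H(1)] by simp
  qed
  moreover have "\<phi> a = 1"
  proof -
    have "\<zero> \<oplus> 1 \<odot> a = a" using a by simp
    then show ?thesis using \<phi>[OF linear_subspaceD(2)[OF H(1)], of 1] by simp
  qed
  ultimately show ?thesis by (intro bexI[of _ \<phi>]) auto
qed

text \<open>The main tool for identities between finite sums in an algebra: after application of
  \<open>\<phi>\<close> they concern sums of complex numbers.\<close>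

lemma eq_if_linear_forms_eq:
  assumes "x \<in> carrier A" "y \<in> carrier A" "\<And>\<phi>. \<phi> \<in> linear_forms A \<Longrightarrow> \<phi> x = \<phi> y"
  shows "x = y"
proof (rule ccontr)
  assume "x \<noteq> y"
  have "(x \<ominus> y) \<oplus> y = x"
    using assms(1,2) by (simp add: a_minus_def plus_assoc left_neg)
  then have "x \<ominus> y \<noteq> \<zero>" using assms(1,2) \<open>x \<noteq> y\<close> by auto
  then obtain \<phi> where "\<phi> \<in> linear_forms A" "\<phi> (x \<ominus> y) \<noteq> 0"
    using ex_linear_form_nonzero[of "x \<ominus> y"] assms(1,2) by auto
  then show False using assms linear_form_minus[of \<phi> x y] by simp
qed

end

section \<open>Multilinear forms\<close>

lemma multilinear_formD:
  assumes "multilinear R A complex_cstar f" "a \<in> (\<Pi>\<^sub>E r\<in>R. carrier (A r))" "r \<in> R"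
  shows "(\<lambda>y. f (a(r := y))) \<in> linear_forms (A r)"
  using assms unfolding multilinear_def by blast

lemma multilinear_prod:
  assumes "finite R" and \<phi>: "\<And>r. r \<in> R \<Longrightarrow> \<phi> r \<in> linear_forms (A r)"
  shows "multilinear R A complex_cstar (\<lambda>a. \<Prod>r\<in>R. \<phi> r (a r))"
proof -
  have "(\<lambda>y. \<Prod>p\<in>R. \<phi> p ((a(r := y)) p)) \<in> linear_forms (A r)" if r: "r \<in> R" for a r
  proof -
    have "(\<Prod>p\<in>R. \<phi> p ((a(r := y)) p)) = \<phi> r y * (\<Prod>p\<in>R - {r}. \<phi> p (a p))" for y
      using r assms(1) by (subst prod.remove[of _ r]) (auto intro!: prod.cong)
    then show ?thesis
      using \<phi>[OF r] by (auto intro!: linear_formI simp: linear_form_add linear_form_scale algebra_simps)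
  qed
  then show ?thesis by (auto simp: multilinear_def complex_cstar_def)
qed

lemma multilinear_compose:
  assumes "multilinear R A T \<tau>" "g \<in> linear_forms T"
  shows "multilinear R A complex_cstar (\<lambda>a. g (\<tau> a))"
proof -
  have "(\<lambda>y. g (\<tau> (a(r := y)))) \<in> linear_forms (A r)"
    if "a \<in> (\<Pi>\<^sub>E r\<in>R. carrier (A r))" "r \<in> R" for a r
  proof -
    have "(\<lambda>y. \<tau> (a(r := y))) \<in> linear_maps (A r) T"
      using assms(1) that unfolding multilinear_def by blast
    then show ?thesis using assms(2) by (auto simp: linear_maps_def Pi_iff)
  qed
  then show ?thesis by (auto simp: multilinear_def complex_cstar_def)
qed

lemma sum_PiE_insert:
  assumes "q \<notin> Q"
  shows "(\<Sum>t\<in>Pi\<^sub>E (insert q Q) T. F t) = (\<Sum>y\<in>T q. \<Sum>g\<in>Pi\<^sub>E Q T. F (g(q := y)))"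
  unfolding PiE_insert_eq using assms
  by (subst sum.reindex[OF inj_combinator]) (auto simp: sum.cartesian_product intro!: sum.cong)

text \<open>Multilinear expansion in all the arguments \<open>d r \<odot> z r\<close> at once, each of them being given as a
  linear combination of the \<open>w r t\<close>. The arguments are expanded one after the other: the
  induction is over the set \<open>Q\<close> of those already expanded, and \<open>b\<close> supplies the others.\<close>

lemma multilinear_form_combination:
  assumes f: "multilinear R A complex_cstar f" and R: "finite R"
    and A: "\<And>r. r \<in> R \<Longrightarrow> cstar_algebra (A r)"
    and T: "\<And>r. r \<in> R \<Longrightarrow> finite (T r)"
    and w: "\<And>r t. r \<in> R \<Longrightarrow> t \<in> T r \<Longrightarrow> w r t \<in> carrier (A r)"
    and z: "\<And>r. r \<in> R \<Longrightarrow> z r \<in> carrier (A r)"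
    and eq: "\<And>r. r \<in> R \<Longrightarrow> (\<Oplus>\<^bsub>A r\<^esub>t\<in>T r. c r t \<odot>\<^bsub>A r\<^esub> w r t) = d r \<odot>\<^bsub>A r\<^esub> z r"
  shows "(\<Sum>t\<in>Pi\<^sub>E R T. (\<Prod>r\<in>R. c r (t r)) * f (\<lambda>r\<in>R. w r (t r))) = (\<Prod>r\<in>R. d r) * f (\<lambda>r\<in>R. z r)"
proof -
  have "(\<Sum>t\<in>Pi\<^sub>E Q T. (\<Prod>r\<in>Q. c r (t r)) * f (\<lambda>r\<in>R. if r \<in> Q then w r (t r) else b r)) =
      (\<Prod>r\<in>Q. d r) * f (\<lambda>r\<in>R. if r \<in> Q then z r else b r)"
    if "Q \<subseteq> R" "b \<in> (\<Pi> r\<in>R. carrier (A r))" for Q b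
    using finite_subset[OF that(1) R] that
  proof (induction Q arbitrary: b rule: finite_induct)
    case (insert q Q)
    then have q: "q \<in> R" and b: "b \<in> (\<Pi> r\<in>R. carrier (A r))" by auto
    interpret cstar_algebra "A q" using A q by blast
    define a where "a = (\<lambda>r\<in>R. if r \<in> Q then z r else b r)"
    have a: "a \<in> (\<Pi>\<^sub>E r\<in>R. carrier (A r))" using z b by (auto simp: a_def)
    define \<phi> where "\<phi> y = f (a(q := y))" for y
    have \<phi>: "\<phi> \<in> linear_forms (A q)" unfolding \<phi>_def by (rule multilinear_formD[OF f a q])
    have "(\<Sum>t\<in>Pi\<^sub>E (insert q Q) T. (\<Prod>r\<in>insert q Q. c r (t r)) *
            f (\<lambda>r\<in>R. if r \<in> insert q Q then w r (t r) else b r)) =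
        (\<Sum>y\<in>T q. \<Sum>g\<in>Pi\<^sub>E Q T. c q y * ((\<Prod>r\<in>Q. c r (g r)) *
            f (\<lambda>r\<in>R. if r \<in> Q then w r (g r) else (b(q := w q y)) r)))"
      unfolding sum_PiE_insert[OF insert.hyps(2)]
    proof (intro sum.cong refl)
      fix y g
      have "(\<lambda>r\<in>R. if r \<in> insert q Q then w r ((g(q := y)) r) else b r) =
          (\<lambda>r\<in>R. if r \<in> Q then w r (g r) else (b(q := w q y)) r)"
        using insert.hyps(2) by auto
      moreover have "(\<Prod>r\<in>insert q Q. c r ((g(q := y)) r)) = c q y * (\<Prod>r\<in>Q. c r (g r))"
        using insert.hyps by (auto intro!: prod.cong)
      ultimately show "(\<Prod>r\<in>insert q Q. c r ((g(q := y)) r)) *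
            f (\<lambda>r\<in>R. if r \<in> insert q Q then w r ((g(q := y)) r) else b r) =
          c q y * ((\<Prod>r\<in>Q. c r (g r)) *
            f (\<lambda>r\<in>R. if r \<in> Q then w r (g r) else (b(q := w q y)) r))"
        by (simp only: mult.assoc)
    qed
    also have "\<dots> = (\<Sum>y\<in>T q. c q y * ((\<Prod>r\<in>Q. d r) * \<phi> (w q y)))"
    proof (intro sum.cong refl)
      fix y assume y: "y \<in> T q"
      have "(\<lambda>r\<in>R. if r \<in> Q then z r else (b(q := w q y)) r) = a(q := w q y)"
        using q insert.hyps(2) by (auto simp: a_def)
      moreover have "b(q := w q y) \<in> (\<Pi> r\<in>R. carrier (A r))" using b w[OF q y] by auto
      ultimately show "(\<Sum>g\<in>Pi\<^sub>E Q T. c q y * ((\<Prod>r\<in>Q. c r (g r)) *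
            f (\<lambda>r\<in>R. if r \<in> Q then w r (g r) else (b(q := w q y)) r))) =
          c q y * ((\<Prod>r\<in>Q. d r) * \<phi> (w q y))"
        using insert.IH[of "b(q := w q y)"] insert.prems(1)
        by (simp only: \<phi>_def insert_subset flip: sum_distrib_left)
    qed
    also have "\<dots> = (\<Prod>r\<in>Q. d r) * (\<Sum>y\<in>T q. c q y * \<phi> (w q y))"
      by (simp add: sum_distrib_left algebra_simps)
    also have "(\<Sum>y\<in>T q. c q y * \<phi> (w q y)) = d q * \<phi> (z q)"
      using linear_form_combination[OF \<phi> T[OF q], of "w q" "c q"] w[OF q] eq[OF q] z[OF q]
      by (simp add: linear_form_scale[OF \<phi>])
    also have "\<phi> (z q) = f (\<lambda>r\<in>R. if r \<in> insert q Q then z r else b r)"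
      unfolding \<phi>_def by (rule arg_cong[where f = f]) (use q in \<open>auto simp: a_def\<close>)
    finally show ?case using insert.hyps by (simp only: prod.insert mult_ac not_False_eq_True)
  qed simp
  from this[of R z] z show ?thesis
    by (simp cong: restrict_cong prod.cong sum.cong)
qed


section \<open>Tuples of multi-indices\<close>

text \<open>The identification of the \<open>k\<close>-th tensor power of a tensor product with the tensor
  product of the \<open>k\<close>-th tensor powers of the factors, on the level of indices.\<close>

definition components :: "'r set \<Rightarrow> ('r \<Rightarrow> 'i) list \<Rightarrow> 'r \<Rightarrow> 'i list" where
  "components R is = (\<lambda>r\<in>R. map (\<lambda>i. i r) is)"

lemma finite_tuples: "finite X \<Longrightarrow> finite (tuples X k)"
  unfolding tuples_def by (rule finite_lists_length_eq)

lemma bij_betw_components: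
  "bij_betw (components R) (tuples (Pi\<^sub>E R X) k) (\<Pi>\<^sub>E r\<in>R. tuples (X r) k)"
proof (rule bij_betwI[where g = "\<lambda>t. map (\<lambda>p. \<lambda>r\<in>R. t r ! p) [0..<k]"])
  show "components R \<in> tuples (Pi\<^sub>E R X) k \<rightarrow> (\<Pi>\<^sub>E r\<in>R. tuples (X r) k)"
    by (auto simp: components_def tuples_def PiE_iff subset_iff)
  show "(\<lambda>t. map (\<lambda>p. \<lambda>r\<in>R. t r ! p) [0..<k]) \<in> (\<Pi>\<^sub>E r\<in>R. tuples (X r) k) \<rightarrow> tuples (Pi\<^sub>E R X) k"
    by (auto simp: tuples_def PiE_iff subset_iff)
  show "map (\<lambda>p. \<lambda>r\<in>R. components R is r ! p) [0..<k] = is" if "is \<in> tuples (Pi\<^sub>E R X) k" for "is"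
  proof (rule nth_equalityI)
    fix p assume "p < length (map (\<lambda>p. \<lambda>r\<in>R. components R is r ! p) [0..<k])"
    then have p: "p < k" by simp
    then have "is ! p \<in> Pi\<^sub>E R X" using that nth_mem[of p "is"] unfolding tuples_def by blast
    then have "(\<lambda>r\<in>R. (is ! p) r) = is ! p" by (rule PiE_restrict)
    then show "map (\<lambda>p. \<lambda>r\<in>R. components R is r ! p) [0..<k] ! p = is ! p"
      using p that by (auto simp: components_def tuples_def cong: restrict_cong)
  qed (use that in \<open>auto simp: tuples_def\<close>)
  show "components R (map (\<lambda>p. \<lambda>r\<in>R. t r ! p) [0..<k]) = t"
    if "t \<in> (\<Pi>\<^sub>E r\<in>R. tuples (X r) k)" for t
  proof
    fix r
    show "components R (map (\<lambda>p. \<lambda>r\<in>R. t r ! p) [0..<k]) r = t r"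
    proof (cases "r \<in> R")
      case True
      then have "length (t r) = k" using that by (auto simp: tuples_def)
      then show ?thesis using True map_nth[of "t r"] by (simp add: components_def comp_def)
    next
      case False
      then show ?thesis using that by (auto simp: components_def)
    qed
  qed
qed

lemma components_in:
  "is \<in> tuples (Pi\<^sub>E R X) k \<Longrightarrow> components R is \<in> (\<Pi>\<^sub>E r\<in>R. tuples (X r) k)"
  using bij_betw_components by (rule bij_betw_apply)

section \<open>Words in the coefficients\<close>

lemma color_word_Nil [simp]: "color_word A [] xs = \<one>\<^bsub>A\<^esub>"
  by (simp add: color_word_def)

lemma color_word_Cons [simp]:
  "color_word A (c # e) (x # xs) = color_power A c x \<otimes>\<^bsub>A\<^esub> color_word A e xs"
  by (simp add: color_word_def)

lemma (in cstar_algebra) color_power_closed: "x \<in> carrier A \<Longrightarrow> color_power A c x \<in> carrier A"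
  by (cases c) (auto simp: adj_closed)

lemma (in cstar_algebra) color_word_closed:
  "set xs \<subseteq> carrier A \<Longrightarrow> length xs = length e \<Longrightarrow> color_word A e xs \<in> carrier A"
proof (induction e arbitrary: xs)
  case Nil
  then show ?case using ring.ring_simprules(6)[OF ring_A] by simp
next
  case (Cons c e)
  then show ?case
    using ring.ring_simprules(5)[OF ring_A] by (cases xs) (auto simp: color_power_closed)
qed

lemma (in cstar_algebra) tensor_power_closed:
  assumes "is \<in> tuples X (length e)" "js \<in> tuples X (length e)"
    and "\<And>i j. i \<in> X \<Longrightarrow> j \<in> X \<Longrightarrow> u i j \<in> carrier A"
  shows "tensor_power A u e is js \<in> carrier A"
  unfolding tensor_power_def using assms
  by (intro color_word_closed) (auto simp: tuples_def set_zip subset_iff)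

text \<open>The counit maps the matrix \<open>u\<close> to the identity, hence also its tensor powers; adjoints
  do no harm because the entries of the identity are real.\<close>

lemma counit_tensor_power:
  assumes A: "cstar_algebra A" and \<epsilon>: "\<epsilon> \<in> cstar_hom A complex_cstar"
    and u: "\<And>i j. i \<in> X \<Longrightarrow> j \<in> X \<Longrightarrow> u i j \<in> carrier A"
    and counit: "\<And>i j. i \<in> X \<Longrightarrow> j \<in> X \<Longrightarrow> \<epsilon> (u i j) = of_bool (i = j)"
    and "is \<in> tuples X (length e)" "js \<in> tuples X (length e)"
  shows "\<epsilon> (tensor_power A u e is js) = of_bool (is = js)"
  using assms(5,6)
proof (induction e arbitrary: "is" js)
  case Nil
  then show ?case using \<epsilon> by (auto simp: tensor_power_def tuples_def cstar_hom_def complex_cstar_def)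
next
  case (Cons c e)
  interpret cstar_algebra A by (rule A)
  from Cons.prems obtain i is' j js' where eq: "is = i # is'" "js = j # js'"
    and ij: "i \<in> X" "j \<in> X" and *: "is' \<in> tuples X (length e)" "js' \<in> tuples X (length e)"
    by (cases "is"; cases js) (auto simp: tuples_def)
  have "tensor_power A u (c # e) is js = color_power A c (u i j) \<otimes>\<^bsub>A\<^esub> tensor_power A u e is' js'"
    by (simp add: tensor_power_def eq)
  moreover have "\<epsilon> (color_power A c (u i j)) = of_bool (i = j)"
    using \<epsilon> u[OF ij] counit[OF ij] by (cases c) (auto simp: cstar_hom_def complex_cstar_def)
  ultimately show ?case
    using \<epsilon> color_power_closed[OF u[OF ij], of c] tensor_power_closed[OF * u] Cons.IH[OF *]
    by (auto simp: eq cstar_hom_def complex_cstar_def)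
qed

section \<open>Fixed vectors\<close>

lemma Fix_spaceI:
  assumes A: "cstar_algebra A" and X: "finite X"
    and u: "\<And>i j. i \<in> X \<Longrightarrow> j \<in> X \<Longrightarrow> u i j \<in> carrier A"
    and supp: "\<And>is. \<xi> is \<noteq> 0 \<Longrightarrow> is \<in> tuples X (length e)"
    and fixed: "\<And>\<phi> is. \<phi> \<in> linear_forms A \<Longrightarrow> is \<in> tuples X (length e) \<Longrightarrow>
      (\<Sum>js\<in>tuples X (length e). \<xi> js * \<phi> (tensor_power A u e is js)) = \<xi> is * \<phi> \<one>\<^bsub>A\<^esub>"
  shows "\<xi> \<in> Fix_space X A u e"
proof -
  interpret cstar_algebra A by (rule A)
  have one: "\<one>\<^bsub>A\<^esub> \<in> carrier A" using ring.ring_simprules(6)[OF ring_A] .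
  have "(\<Oplus>\<^bsub>A\<^esub>js\<in>tuples X (length e). \<xi> js \<odot>\<^bsub>A\<^esub> tensor_power A u e is js) = \<xi> is \<odot>\<^bsub>A\<^esub> \<one>\<^bsub>A\<^esub>"
    if "is": "is \<in> tuples X (length e)" for "is"
  proof (rule eq_if_linear_forms_eq)
    have cl: "tensor_power A u e is js \<in> carrier A" if "js \<in> tuples X (length e)" for js
      using tensor_power_closed[OF "is" that u] .
    then show "(\<Oplus>\<^bsub>A\<^esub>js\<in>tuples X (length e). \<xi> js \<odot>\<^bsub>A\<^esub> tensor_power A u e is js) \<in> carrier A"
      by (intro abelian_monoid.finsum_closed[OF abelian_monoid_A]) auto
    fix \<phi> assume \<phi>: "\<phi> \<in> linear_forms A"
    show "\<phi> (\<Oplus>\<^bsub>A\<^esub>js\<in>tuples X (length e). \<xi> js \<odot>\<^bsub>A\<^esub> tensor_power A u e is js) = \<phi> (\<xi> is \<odot>\<^bsub>A\<^esub> \<one>\<^bsub>A\<^esub>)"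
      using fixed[OF \<phi> "is"] cl finite_tuples[OF X]
      by (simp add: linear_form_combination[OF \<phi>] linear_form_scale[OF \<phi> one])
  qed (use one in simp)
  then show ?thesis using supp by (auto simp: Fix_space_def)
qed

lemma Fix_spaceD:
  assumes \<xi>: "\<xi> \<in> Fix_space X A u e" and A: "cstar_algebra A" and X: "finite X"
    and u: "\<And>i j. i \<in> X \<Longrightarrow> j \<in> X \<Longrightarrow> u i j \<in> carrier A"
    and \<phi>: "\<phi> \<in> linear_forms A" and "is": "is \<in> tuples X (length e)"
  shows "(\<Sum>js\<in>tuples X (length e). \<xi> js * \<phi> (tensor_power A u e is js)) = \<xi> is * \<phi> \<one>\<^bsub>A\<^esub>"
proof -
  interpret cstar_algebra A by (rule A)
  have "\<phi> (\<Oplus>\<^bsub>A\<^esub>js\<in>tuples X (length e). \<xi> js \<odot>\<^bsub>A\<^esub> tensor_power A u e is js) = \<phi> (\<xi> is \<odot>\<^bsub>A\<^esub> \<one>\<^bsub>A\<^esub>)"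
    using \<xi> "is" by (simp add: Fix_space_def)
  then show ?thesis
    using tensor_power_closed[OF "is" _ u] finite_tuples[OF X] ring.ring_simprules(6)[OF ring_A]
    by (simp add: linear_form_combination[OF \<phi>] linear_form_scale[OF \<phi>])
qed

text \<open>The tensor power of length zero is the unit matrix of size one, so fixed vectors are
  intertwiners from it.\<close>

lemma Fix_space_eq_Hom_space:
  assumes "cstar_algebra A" and u: "\<And>i j. i \<in> X \<Longrightarrow> j \<in> X \<Longrightarrow> u i j \<in> carrier A"
    and X: "finite X"
  shows "\<xi> \<in> Fix_space X A u e \<longleftrightarrow> (\<lambda>js is. if is = [] then \<xi> js else 0) \<in> Hom_space X A u [] e"
proof -
  interpret cstar_algebra A by fact
  have [simp]: "tuples X 0 = {[]}" by (auto simp: tuples_def)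
  have [simp]: "\<one>\<^bsub>A\<^esub> \<in> carrier A" using ring.ring_simprules(6)[OF ring_A] .
  have *: "(\<Oplus>\<^bsub>A\<^esub>as\<in>{[]}. f as) = f []" if "f [] \<in> carrier A" for f :: "'b list \<Rightarrow> 'a"
    using that abelian_monoid.finsum_insert[OF abelian_monoid_A, of "{}" "[]" f]
      abelian_monoid.finsum_empty[OF abelian_monoid_A, of f]
      abelian_monoid.r_zero[OF abelian_monoid_A, of "f []"] by auto
  have "(\<Oplus>\<^bsub>A\<^esub>as\<in>{[]}. (if as = [] then \<xi> js else 0) \<odot>\<^bsub>A\<^esub> tensor_power A u [] as []) = \<xi> js \<odot>\<^bsub>A\<^esub> \<one>\<^bsub>A\<^esub>" for js
    by (subst *) (simp_all add: tensor_power_def)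
  then have **: "(\<lambda>js is. if is = [] then \<xi> js else 0) \<in> Hom_space X A u [] e \<longleftrightarrow>
      (\<forall>js. \<xi> js \<noteq> 0 \<longrightarrow> js \<in> tuples X (length e)) \<and>
      (\<forall>js\<in>tuples X (length e). \<xi> js \<odot>\<^bsub>A\<^esub> \<one>\<^bsub>A\<^esub> =
        (\<Oplus>\<^bsub>A\<^esub>bs\<in>tuples X (length e). \<xi> bs \<odot>\<^bsub>A\<^esub> tensor_power A u e js bs))"
    unfolding Hom_space_def by simp
  show ?thesis unfolding ** Fix_space_def mem_Collect_eq by (metis (no_types))
qed

section \<open>Vectors with all slices in given spans\<close>

text \<open>A sum collapses to a slice when its terms contain a Kronecker symbol in every direction
  but \<open>q\<close>.\<close>

lemma sum_PiE_slice:
  assumes "finite R" "\<And>r. r \<in> R \<Longrightarrow> finite (T r)" and t: "t \<in> Pi\<^sub>E R T" and q: "q \<in> R"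
    and zero: "\<And>t' r. t' \<in> Pi\<^sub>E R T \<Longrightarrow> r \<in> R \<Longrightarrow> r \<noteq> q \<Longrightarrow> t' r \<noteq> t r \<Longrightarrow> F t' = 0"
  shows "(\<Sum>t'\<in>Pi\<^sub>E R T. F t') = (\<Sum>j\<in>T q. F (t(q := j)))"
proof -
  have "(\<Sum>t'\<in>Pi\<^sub>E R T. F t') = (\<Sum>t'\<in>(\<lambda>j. t(q := j)) ` T q. F t')"
  proof (rule sum.mono_neutral_right)
    show "finite (Pi\<^sub>E R T)" using assms(1,2) by (rule finite_PiE)
    show "(\<lambda>j. t(q := j)) ` T q \<subseteq> Pi\<^sub>E R T" using t q by (auto simp: PiE_iff extensional_def)
    show "\<forall>t'\<in>Pi\<^sub>E R T - (\<lambda>j. t(q := j)) ` T q. F t' = 0"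
    proof
      fix t' assume t': "t' \<in> Pi\<^sub>E R T - (\<lambda>j. t(q := j)) ` T q"
      then have "t' q \<in> T q" using q by auto
      then have "t' \<noteq> t(q := t' q)" using t' by blast
      then obtain r where "t' r \<noteq> (t(q := t' q)) r" by blast
      then have r: "r \<noteq> q" "t' r \<noteq> t r" by (auto split: if_splits)
      then have "r \<in> R" using t t' by (auto simp: PiE_iff extensional_def)
      then show "F t' = 0" using zero r t' by blast
    qed
  qed
  also have "\<dots> = (\<Sum>j\<in>T q. F (t(q := j)))"
    by (subst sum.reindex) (auto simp: inj_on_def dest: fun_upd_eqD)
  finally show ?thesis .
qed

text \<open>The matrix \<open>(\<Sum>\<pi>\<in>P. v \<pi> i * q \<pi> j)\<close> is a projection onto the span of the \<open>v \<pi>\<close>, given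
  in a form that makes visible that its values are combinations of the \<open>v \<pi>\<close>. When a vector
  \<open>v p\<close> is added, let \<open>w\<close> be the part of \<open>v p\<close> that the projection found so far misses. If
  \<open>w\<close> vanishes, nothing has to be done; otherwise some coordinate of \<open>w\<close> is nonzero, and the
  projection is corrected by a rank one operator with image \<open>w\<close> that vanishes on the old span.\<close>

lemma ex_span_projection:
  fixes v :: "'p \<Rightarrow> 't \<Rightarrow> complex"
  assumes "finite P" and X: "finite X"
  shows "\<exists>q. \<forall>\<sigma>\<in>P. \<forall>i\<in>X. v \<sigma> i = (\<Sum>\<pi>\<in>P. (\<Sum>j\<in>X. q \<pi> j * v \<sigma> j) * v \<pi> i)"
  using assms(1)
proof (induction P rule: finite_induct)
  case (insert p P)
  then obtain q where q: "\<And>\<sigma> i. \<sigma> \<in> P \<Longrightarrow> i \<in> X \<Longrightarrow>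
      v \<sigma> i = (\<Sum>\<pi>\<in>P. (\<Sum>j\<in>X. q \<pi> j * v \<sigma> j) * v \<pi> i)" by blast
  \<comment> \<open>\<open>w \<sigma>\<close> is the remainder of \<open>v \<sigma>\<close> under the old projection; the linear form \<open>l\<close> vanishes on
    the old span and takes the value 1 at \<open>v p\<close>, unless the remainder of \<open>v p\<close> is zero.\<close>
  define a where "a \<sigma> \<pi> = (\<Sum>j\<in>X. q \<pi> j * v \<sigma> j)" for \<sigma> \<pi>
  define w where "w \<sigma> i = v \<sigma> i - (\<Sum>\<pi>\<in>P. a \<sigma> \<pi> * v \<pi> i)" for \<sigma> i
  have w0: "w \<sigma> i = 0" if "\<sigma> \<in> P" "i \<in> X" for \<sigma> i using q[OF that] by (simp add: w_def a_def)
  obtain l where l: "\<And>\<sigma>. \<sigma> \<in> P \<Longrightarrow> (\<Sum>j\<in>X. l j * v \<sigma> j) = 0"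
    and lp: "\<And>i. i \<in> X \<Longrightarrow> (\<Sum>j\<in>X. l j * v p j) * w p i = w p i"
  proof (cases "\<forall>i\<in>X. w p i = 0")
    case True
    then show thesis using that[of "\<lambda>_. 0"] by simp
  next
    case False
    then obtain i0 where i0: "i0 \<in> X" "w p i0 \<noteq> 0" by blast
    \<comment> \<open>This is the form \<open>v \<mapsto> (v - Q v) i0 / w p i0\<close>, where \<open>Q\<close> is the old projection.\<close>
    define l where "l j = (of_bool (j = i0) - (\<Sum>\<pi>\<in>P. q \<pi> j * v \<pi> i0)) / w p i0" for j
    have "(\<Sum>j\<in>X. l j * v \<sigma> j) = w \<sigma> i0 / w p i0" for \<sigma>
    proof -
      have "(\<Sum>j\<in>X. (of_bool (j = i0) - (\<Sum>\<pi>\<in>P. q \<pi> j * v \<pi> i0)) * v \<sigma> j) =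
          (\<Sum>j\<in>X. of_bool (j = i0) * v \<sigma> j) - (\<Sum>j\<in>X. \<Sum>\<pi>\<in>P. q \<pi> j * v \<pi> i0 * v \<sigma> j)"
        by (simp add: algebra_simps sum_subtractf sum_distrib_left sum_distrib_right)
      also have "(\<Sum>j\<in>X. of_bool (j = i0) * v \<sigma> j) = v \<sigma> i0"
        using X i0(1) by (simp add: of_bool_def if_distrib[of "\<lambda>x. x * _"] cong: if_cong)
      also have "(\<Sum>j\<in>X. \<Sum>\<pi>\<in>P. q \<pi> j * v \<pi> i0 * v \<sigma> j) = (\<Sum>\<pi>\<in>P. a \<sigma> \<pi> * v \<pi> i0)"
        unfolding a_def sum_distrib_right by (subst sum.swap) (simp add: algebra_simps)
      finally show ?thesis by (simp add: l_def w_def flip: sum_divide_distrib)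
    qed
    then show thesis using that[of l] w0 i0 by simp
  qed
  define q' where "q' \<pi> j = (if \<pi> = p then l j else q \<pi> j - l j * a p \<pi>)" for \<pi> j
  have "v \<sigma> i = (\<Sum>\<pi>\<in>insert p P. (\<Sum>j\<in>X. q' \<pi> j * v \<sigma> j) * v \<pi> i)"
    if \<sigma>: "\<sigma> \<in> insert p P" and i: "i \<in> X" for \<sigma> i
  proof -
    let ?L = "\<Sum>j\<in>X. l j * v \<sigma> j"
    have q': "(\<Sum>j\<in>X. q' \<pi> j * v \<sigma> j) = a \<sigma> \<pi> - ?L * a p \<pi>" if "\<pi> \<in> P" for \<pi>
    proof -
      have "\<pi> \<noteq> p" using that insert.hyps by auto
      then show ?thesis
        by (simp add: q'_def a_def[of \<sigma>] algebra_simps sum_subtractf sum_distrib_left)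
    qed
    have "(\<Sum>\<pi>\<in>insert p P. (\<Sum>j\<in>X. q' \<pi> j * v \<sigma> j) * v \<pi> i) =
        (\<Sum>j\<in>X. q' p j * v \<sigma> j) * v p i + (\<Sum>\<pi>\<in>P. (a \<sigma> \<pi> - ?L * a p \<pi>) * v \<pi> i)"
      using insert.hyps q' by simp
    also have "\<dots> = (v \<sigma> i - w \<sigma> i) + ?L * w p i"
      by (simp add: q'_def w_def algebra_simps sum_subtractf sum_distrib_left)
    also have "\<dots> = v \<sigma> i"
      using \<sigma> l lp[OF i] w0 i by auto
    finally show ?thesis by simp
  qed
  then show ?case by blast
qed simp

text \<open>Slices in the directions \<open>Q\<close> are reproduced by the projections of \<open>ex_span_projection\<close>.
  Applying these one direction at a time, each leaves a coefficient that is
  constant in the directions treated so far: \<open>c \<pi> t\<close> depends only on the coordinates of \<open>t\<close>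
  outside \<open>Q\<close>. In the end it does not depend on \<open>t \<in> Pi\<^sub>E R T\<close> at all.\<close>

lemma ex_tensor_expansion:
  fixes F :: "('r \<Rightarrow> 't) \<Rightarrow> complex" and v :: "'r \<Rightarrow> 'p \<Rightarrow> 't \<Rightarrow> complex"
  assumes "finite Q" "Q \<subseteq> R"
    and T: "\<And>r. r \<in> R \<Longrightarrow> finite (T r)" and P: "\<And>r. r \<in> R \<Longrightarrow> finite (P r)"
    and slice: "\<And>r t. r \<in> R \<Longrightarrow> t \<in> Pi\<^sub>E R T \<Longrightarrow>
      \<exists>c. \<forall>j\<in>T r. F (t(r := j)) = (\<Sum>\<pi>\<in>P r. c \<pi> * v r \<pi> j)"
  shows "\<exists>c. (\<forall>\<pi> t t'. (\<forall>r. r \<notin> Q \<longrightarrow> t r = t' r) \<longrightarrow> c \<pi> t = c \<pi> t') \<and>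
    (\<forall>t\<in>Pi\<^sub>E R T. F t = (\<Sum>\<pi>\<in>Pi\<^sub>E Q P. c \<pi> t * (\<Prod>r\<in>Q. v r (\<pi> r) (t r))))"
  using assms(1,2)
proof (induction Q rule: finite_induct)
  case empty
  show ?case by (intro exI[of _ "\<lambda>_. F"]) (auto intro!: arg_cong[of _ _ F])
next
  case (insert q Q)
  then have "Q \<subseteq> R" by auto
  from insert.IH[OF this] obtain c
    where c: "\<forall>\<pi> t t'. (\<forall>r. r \<notin> Q \<longrightarrow> t r = t' r) \<longrightarrow> c \<pi> t = c \<pi> t'"
    and F: "\<forall>t\<in>Pi\<^sub>E R T. F t = (\<Sum>\<pi>\<in>Pi\<^sub>E Q P. c \<pi> t * (\<Prod>r\<in>Q. v r (\<pi> r) (t r)))"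
    by (elim exE conjE) (rule that)
  have q: "q \<in> R" "q \<notin> Q" using insert by auto
  obtain p where p: "\<And>\<sigma> i. \<sigma> \<in> P q \<Longrightarrow> i \<in> T q \<Longrightarrow>
      v q \<sigma> i = (\<Sum>\<pi>\<in>P q. (\<Sum>j\<in>T q. p \<pi> j * v q \<sigma> j) * v q \<pi> i)"
    using ex_span_projection[OF P T, OF q(1) q(1), of "v q"] by blast
  \<comment> \<open>the coefficient of \<open>v q (\<pi> q)\<close> in the projection of the slice of \<open>c (restrict \<pi> Q)\<close>\<close>
  define c' where "c' \<pi> t = (\<Sum>j\<in>T q. p (\<pi> q) j * c (restrict \<pi> Q) (t(q := j)))" for \<pi> t
  have "F t = (\<Sum>\<pi>\<in>Pi\<^sub>E (insert q Q) P. c' \<pi> t * (\<Prod>r\<in>insert q Q. v r (\<pi> r) (t r)))"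
    if t: "t \<in> Pi\<^sub>E R T" for t
  proof -
    obtain d where d: "\<And>j. j \<in> T q \<Longrightarrow> F (t(q := j)) = (\<Sum>\<sigma>\<in>P q. d \<sigma> * v q \<sigma> j)"
      using slice[OF q(1) t] by blast
    have tq: "t q \<in> T q" using t q by auto
    have "F t = F (t(q := t q))" by simp
    also have "\<dots> = (\<Sum>\<sigma>\<in>P q. d \<sigma> * (\<Sum>\<pi>\<in>P q. (\<Sum>j\<in>T q. p \<pi> j * v q \<sigma> j) * v q \<pi> (t q)))"
      unfolding d[OF tq] using p[OF _ tq] by simp
    also have "\<dots> = (\<Sum>\<pi>\<in>P q. \<Sum>\<sigma>\<in>P q. \<Sum>j\<in>T q. p \<pi> j * (d \<sigma> * v q \<sigma> j) * v q \<pi> (t q))"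
      unfolding sum_distrib_left sum_distrib_right by (subst sum.swap) (simp add: algebra_simps)
    also have "\<dots> = (\<Sum>\<pi>\<in>P q. (\<Sum>j\<in>T q. p \<pi> j * F (t(q := j))) * v q \<pi> (t q))"
      by (intro sum.cong refl, subst sum.swap) (simp add: d sum_distrib_left sum_distrib_right)
    also have "\<dots> = (\<Sum>\<pi>\<in>P q. \<Sum>g\<in>Pi\<^sub>E Q P.
        (\<Sum>j\<in>T q. p \<pi> j * c g (t(q := j))) * (v q \<pi> (t q) * (\<Prod>r\<in>Q. v r (g r) (t r))))"
    proof (intro sum.cong refl)
      fix \<pi>
      have "F (t(q := j)) = (\<Sum>g\<in>Pi\<^sub>E Q P. c g (t(q := j)) * (\<Prod>r\<in>Q. v r (g r) (t r)))"
        if "j \<in> T q" for j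
      proof -
        have "t(q := j) \<in> Pi\<^sub>E R T" using t q that by (auto simp: PiE_iff extensional_def)
        moreover have "(\<Prod>r\<in>Q. v r (g r) ((t(q := j)) r)) = (\<Prod>r\<in>Q. v r (g r) (t r))" for g
          using q by (intro prod.cong) auto
        ultimately show ?thesis using F by simp
      qed
      then have "(\<Sum>j\<in>T q. p \<pi> j * F (t(q := j))) * v q \<pi> (t q) =
        (\<Sum>j\<in>T q. \<Sum>g\<in>Pi\<^sub>E Q P. p \<pi> j * c g (t(q := j)) * (v q \<pi> (t q) * (\<Prod>r\<in>Q. v r (g r) (t r))))"
        by (simp add: sum_distrib_left sum_distrib_right algebra_simps)
      also have "\<dots> = (\<Sum>g\<in>Pi\<^sub>E Q P. \<Sum>j\<in>T q. p \<pi> j * c g (t(q := j)) *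
          (v q \<pi> (t q) * (\<Prod>r\<in>Q. v r (g r) (t r))))"
        by (rule sum.swap)
      finally show "(\<Sum>j\<in>T q. p \<pi> j * F (t(q := j))) * v q \<pi> (t q) = (\<Sum>g\<in>Pi\<^sub>E Q P.
        (\<Sum>j\<in>T q. p \<pi> j * c g (t(q := j))) * (v q \<pi> (t q) * (\<Prod>r\<in>Q. v r (g r) (t r))))"
        by (simp only: sum_distrib_right)
    qed
    also have "\<dots> = (\<Sum>\<pi>\<in>P q. \<Sum>g\<in>Pi\<^sub>E Q P. c' (g(q := \<pi>)) t *
        (\<Prod>r\<in>insert q Q. v r ((g(q := \<pi>)) r) (t r)))"
    proof (intro sum.cong refl)
      fix \<pi> g assume "g \<in> Pi\<^sub>E Q P"
      then have "restrict (g(q := \<pi>)) Q = g"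
        using q by (auto simp: fun_eq_iff PiE_iff extensional_def restrict_def)
      moreover have "(\<Prod>r\<in>insert q Q. v r ((g(q := \<pi>)) r) (t r)) =
          v q \<pi> (t q) * (\<Prod>r\<in>Q. v r (g r) (t r))"
        using insert.hyps by (auto intro!: prod.cong)
      ultimately show "(\<Sum>j\<in>T q. p \<pi> j * c g (t(q := j))) * (v q \<pi> (t q) * (\<Prod>r\<in>Q. v r (g r) (t r))) =
          c' (g(q := \<pi>)) t * (\<Prod>r\<in>insert q Q. v r ((g(q := \<pi>)) r) (t r))"
        by (simp only: c'_def fun_upd_same)
    qed
    also have "\<dots> = (\<Sum>\<pi>\<in>Pi\<^sub>E (insert q Q) P. c' \<pi> t * (\<Prod>r\<in>insert q Q. v r (\<pi> r) (t r)))"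
      using sum_PiE_insert[OF q(2)] by (rule sym)
    finally show ?thesis .
  qed
  moreover have "c' \<pi> t = c' \<pi> t'" if "\<forall>r. r \<notin> insert q Q \<longrightarrow> t r = t' r" for \<pi> t t'
    unfolding c'_def using that by (intro sum.cong refl arg_cong2[of _ _ _ _ "(*)"] c[rule_format]) auto
  ultimately show ?case by (intro exI[of _ c'] conjI) blast+
qed

section \<open>Fixed vectors of a product\<close>

text \<open>The tensor product of the matrices \<open>u r\<close>, over any tensor product \<open>C\<close> of the algebras.\<close>

locale tensor_corepresentation =
  fixes R :: "'r set" and A :: "'r \<Rightarrow> 'a cstar" and C :: "'c cstar" and \<tau> :: "('r \<Rightarrow> 'a) \<Rightarrow> 'c"
    and X :: "'r \<Rightarrow> 'i set" and u :: "'r \<Rightarrow> 'i \<Rightarrow> 'i \<Rightarrow> 'a"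
  assumes finite_R: "finite R" and finite_X: "\<And>r. r \<in> R \<Longrightarrow> finite (X r)"
    and A: "\<And>r. r \<in> R \<Longrightarrow> cstar_algebra (A r)"
    and T: "cstar_tensor_product R A C \<tau>"
    and u: "\<And>r i j. r \<in> R \<Longrightarrow> i \<in> X r \<Longrightarrow> j \<in> X r \<Longrightarrow> u r i j \<in> carrier (A r)"
begin

definition U :: "('r \<Rightarrow> 'i) \<Rightarrow> ('r \<Rightarrow> 'i) \<Rightarrow> 'c" where
  "U i j = \<tau> (\<lambda>r\<in>R. u r (i r) (j r))"

lemma cstar_algebra_C: "cstar_algebra C"
  using T by (simp add: cstar_tensor_product_def)

lemma tau_closed: "a \<in> (\<Pi>\<^sub>E r\<in>R. carrier (A r)) \<Longrightarrow> \<tau> a \<in> carrier C"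
  using T unfolding cstar_tensor_product_def multilinear_def by blast

lemma tau_one: "\<tau> (\<lambda>r\<in>R. \<one>\<^bsub>A r\<^esub>) = \<one>\<^bsub>C\<^esub>"
  using T unfolding cstar_tensor_product_def by blast

lemma one_closed: "r \<in> R \<Longrightarrow> \<one>\<^bsub>A r\<^esub> \<in> carrier (A r)"
  by (rule ring.ring_simprules(6)[OF cstar_algebra.ring_A[OF A]])

lemma U_closed: "i \<in> Pi\<^sub>E R X \<Longrightarrow> j \<in> Pi\<^sub>E R X \<Longrightarrow> U i j \<in> carrier C"
  unfolding U_def by (intro tau_closed restrict_PiE_iff[THEN iffD2] ballI u) (auto simp: PiE_iff)

lemma finite_indices: "finite (Pi\<^sub>E R X)"
  using finite_R finite_X by (rule finite_PiE)

lemma tensor_power_U: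
  assumes "is \<in> tuples (Pi\<^sub>E R X) (length e)" "js \<in> tuples (Pi\<^sub>E R X) (length e)"
  shows "tensor_power C U e is js =
    \<tau> (\<lambda>r\<in>R. tensor_power (A r) (u r) e (components R is r) (components R js r))"
  using assms
proof (induction e arbitrary: "is" js)
  case Nil
  have "\<tau> (\<lambda>r\<in>R. \<one>\<^bsub>A r\<^esub>) = \<one>\<^bsub>C\<^esub>" using T unfolding cstar_tensor_product_def by blast
  then show ?case by (simp only: tensor_power_def color_word_Nil)
next
  case (Cons c e)
  from Cons.prems obtain i is' j js' where eq: "is = i # is'" "js = j # js'"
    and ij: "i \<in> Pi\<^sub>E R X" "j \<in> Pi\<^sub>E R X"
    and *: "is' \<in> tuples (Pi\<^sub>E R X) (length e)" "js' \<in> tuples (Pi\<^sub>E R X) (length e)"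
    by (cases "is"; cases js) (auto simp: tuples_def)
  let ?w = "\<lambda>r. tensor_power (A r) (u r) e (components R is' r) (components R js' r)"
  let ?v = "\<lambda>r. color_power (A r) c (u r (i r) (j r))"
  have uc: "u r (i r) (j r) \<in> carrier (A r)" if "r \<in> R" for r
    using that ij u[OF that] by auto
  have w: "(\<lambda>r\<in>R. ?w r) \<in> (\<Pi>\<^sub>E r\<in>R. carrier (A r))"
  proof (rule restrict_PiE_iff[THEN iffD2], intro ballI)
    fix r assume r: "r \<in> R"
    then show "?w r \<in> carrier (A r)"
      using components_in[OF *(1)] components_in[OF *(2)] u[OF r]
      by (intro cstar_algebra.tensor_power_closed[OF A[OF r], where X = "X r"]) (auto simp: PiE_iff)
  qed
  have v: "(\<lambda>r\<in>R. ?v r) \<in> (\<Pi>\<^sub>E r\<in>R. carrier (A r))"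
    using cstar_algebra.color_power_closed[OF A uc] by auto
  have "color_power C c (U i j) = \<tau> (\<lambda>r\<in>R. ?v r)"
  proof (cases c)
    case Black
    have "(\<lambda>r\<in>R. u r (i r) (j r)) \<in> (\<Pi>\<^sub>E r\<in>R. carrier (A r))" using uc by auto
    then have "adj C (\<tau> (\<lambda>r\<in>R. u r (i r) (j r))) = \<tau> (\<lambda>r\<in>R. adj (A r) ((\<lambda>r\<in>R. u r (i r) (j r)) r))"
      using T unfolding cstar_tensor_product_def by blast
    then show ?thesis using Black by (simp add: U_def cong: restrict_cong)
  qed (simp add: U_def)
  then have "tensor_power C U (c # e) is js = \<tau> (\<lambda>r\<in>R. ?v r) \<otimes>\<^bsub>C\<^esub> \<tau> (\<lambda>r\<in>R. ?w r)"
    using Cons.IH[OF *] by (simp add: tensor_power_def eq del: restrict_apply)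
  also have "\<dots> = \<tau> (\<lambda>r\<in>R. (\<lambda>r\<in>R. ?v r) r \<otimes>\<^bsub>A r\<^esub> (\<lambda>r\<in>R. ?w r) r)"
    using T v w unfolding cstar_tensor_product_def by blast
  also have "(\<lambda>r\<in>R. (\<lambda>r\<in>R. ?v r) r \<otimes>\<^bsub>A r\<^esub> (\<lambda>r\<in>R. ?w r) r) =
      (\<lambda>r\<in>R. tensor_power (A r) (u r) (c # e) (components R is r) (components R js r))"
    by (auto simp: components_def tensor_power_def eq)
  finally show ?case .
qed

text \<open>Under a linear form \<open>\<phi>\<close> the left-hand side of the equation to be verified is the
  multilinear expansion of \<open>\<phi> \<circ> \<tau>\<close> at the vectors \<open>u_r^k \<eta>_r = \<eta>_r\<close>.\<close>

lemma tensor_product_in_Fix_space: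
  assumes \<eta>: "\<And>r. r \<in> R \<Longrightarrow> \<eta> r \<in> Fix_space (X r) (A r) (u r) e"
  shows "(\<lambda>is. if is \<in> tuples (Pi\<^sub>E R X) (length e) then \<Prod>r\<in>R. \<eta> r (components R is r) else 0)
    \<in> Fix_space (Pi\<^sub>E R X) C U e" (is "?\<xi> \<in> _")
proof (rule Fix_spaceI[OF cstar_algebra_C finite_indices U_closed])
  fix \<phi> "is" assume \<phi>: "\<phi> \<in> linear_forms C" and "is": "is \<in> tuples (Pi\<^sub>E R X) (length e)"
  let ?T = "\<lambda>r. tuples (X r) (length e)"
  let ?w = "\<lambda>r j. tensor_power (A r) (u r) e (components R is r) j"
  have t: "components R is \<in> Pi\<^sub>E R ?T" by (rule components_in[OF "is"])
  have "(\<Sum>js\<in>tuples (Pi\<^sub>E R X) (length e). ?\<xi> js * \<phi> (tensor_power C U e is js)) =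
      (\<Sum>js\<in>tuples (Pi\<^sub>E R X) (length e).
        (\<Prod>r\<in>R. \<eta> r (components R js r)) * \<phi> (\<tau> (\<lambda>r\<in>R. ?w r (components R js r))))"
    using "is" by (intro sum.cong refl) (simp only: tensor_power_U if_True)
  also have "\<dots> = (\<Sum>t\<in>Pi\<^sub>E R ?T. (\<Prod>r\<in>R. \<eta> r (t r)) * \<phi> (\<tau> (\<lambda>r\<in>R. ?w r (t r))))"
    by (rule sum.reindex_bij_betw[OF bij_betw_components])
  also have "\<dots> = (\<Prod>r\<in>R. \<eta> r (components R is r)) * \<phi> (\<tau> (\<lambda>r\<in>R. \<one>\<^bsub>A r\<^esub>))"
  proof (rule multilinear_form_combination[OF multilinear_compose[OF _ \<phi>] finite_R A _ _ one_closed])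
    show "multilinear R A C \<tau>" using T by (simp add: cstar_tensor_product_def)
    show "finite (?T r)" if "r \<in> R" for r using finite_X[OF that] by (rule finite_tuples)
    fix r assume r: "r \<in> R"
    have tr: "components R is r \<in> ?T r" using t r by auto
    show "?w r j \<in> carrier (A r)" if "j \<in> ?T r" for j
      using cstar_algebra.tensor_power_closed[OF A[OF r] tr that u[OF r]] .
    show "(\<Oplus>\<^bsub>A r\<^esub>j\<in>?T r. \<eta> r j \<odot>\<^bsub>A r\<^esub> ?w r j) = \<eta> r (components R is r) \<odot>\<^bsub>A r\<^esub> \<one>\<^bsub>A r\<^esub>"
      using \<eta>[OF r] tr unfolding Fix_space_def by blast
  qed
  finally show "(\<Sum>js\<in>tuples (Pi\<^sub>E R X) (length e). ?\<xi> js * \<phi> (tensor_power C U e is js)) =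
      ?\<xi> is * \<phi> \<one>\<^bsub>C\<^esub>"
    using "is" by (simp only: tau_one if_True)
qed (auto split: if_splits)

text \<open>The equation for a fixed vector \<open>\<xi>\<close> of the product is tested by the linear form on \<open>C\<close> that
  extends \<open>\<phi>\<close> on the factor \<open>q\<close> and the counits on the others. By \<open>counit_tensor_power\<close> only
  the terms differing from \<open>t\<close> in the direction \<open>q\<close> survive, and \<open>\<phi>\<close> being arbitrary,
  the slice of \<open>\<xi>\<close> through \<open>t\<close> in that direction is fixed. Here \<open>F\<close> is \<open>\<xi>\<close> as a function
  of the components.\<close>

lemma slice_in_Fix_space:
  assumes \<epsilon>: "\<And>r. r \<in> R \<Longrightarrow> \<epsilon> r \<in> cstar_hom (A r) complex_cstar"
    and counit: "\<And>r i j. r \<in> R \<Longrightarrow> i \<in> X r \<Longrightarrow> j \<in> X r \<Longrightarrow> \<epsilon> r (u r i j) = of_bool (i = j)"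
    and \<xi>: "\<xi> \<in> Fix_space (Pi\<^sub>E R X) C U e"
    and F: "\<And>is. is \<in> tuples (Pi\<^sub>E R X) (length e) \<Longrightarrow> F (components R is) = \<xi> is"
    and t: "t \<in> (\<Pi>\<^sub>E r\<in>R. tuples (X r) (length e))" and q: "q \<in> R"
  shows "(\<lambda>j. if j \<in> tuples (X q) (length e) then F (t(q := j)) else 0)
    \<in> Fix_space (X q) (A q) (u q) e" (is "?\<eta> \<in> _")
proof (rule Fix_spaceI[OF A[OF q] finite_X[OF q] u[OF q]])
  let ?T = "\<lambda>r. tuples (X r) (length e)"
  fix \<phi> i assume \<phi>: "\<phi> \<in> linear_forms (A q)" and i: "i \<in> ?T q"
  define t0 where "t0 = t(q := i)"
  have t0: "t0 \<in> Pi\<^sub>E R ?T" using t i q by (auto simp: t0_def PiE_iff extensional_def)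
  then have "t0 \<in> components R ` tuples (Pi\<^sub>E R X) (length e)"
    unfolding bij_betw_imp_surj_on[OF bij_betw_components] .
  then obtain "is" where "is": "is \<in> tuples (Pi\<^sub>E R X) (length e)" and comp: "components R is = t0"
    by blast
  \<comment> \<open>\<open>t0\<close> is the row of the equation for \<open>\<xi>\<close> that is tested, \<open>\<psi>\<close> the family of forms.\<close>
  define \<psi> where "\<psi> r = (if r = q then \<phi> else \<epsilon> r)" for r
  have \<psi>: "\<psi> r \<in> linear_forms (A r)" if "r \<in> R" for r
    using \<phi> \<epsilon>[OF that] by (auto simp: \<psi>_def cstar_hom_def)
  obtain g where g: "g \<in> linear_forms C"
    and g_tau: "\<And>a. a \<in> (\<Pi>\<^sub>E r\<in>R. carrier (A r)) \<Longrightarrow> g (\<tau> a) = (\<Prod>r\<in>R. \<psi> r (a r))"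
    using T multilinear_prod[of R \<psi> A, OF finite_R \<psi>] unfolding cstar_tensor_product_def by blast
  let ?w = "\<lambda>r j. tensor_power (A r) (u r) e (t0 r) j"
  have w: "?w r j \<in> carrier (A r)" if "r \<in> R" "j \<in> ?T r" for r j
    using t0 that by (intro cstar_algebra.tensor_power_closed[OF A[OF that(1)] _ that(2) u]) auto
  have \<epsilon>w: "\<epsilon> r (?w r j) = of_bool (t0 r = j)" if "r \<in> R" "j \<in> ?T r" for r j
    using t0 that by (intro counit_tensor_power[OF A \<epsilon> u counit]) auto
  have "(\<Sum>js\<in>tuples (Pi\<^sub>E R X) (length e). \<xi> js * g (tensor_power C U e is js)) = \<xi> is * g \<one>\<^bsub>C\<^esub>"
    by (rule Fix_spaceD[OF \<xi> cstar_algebra_C finite_indices U_closed g "is"])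
  also have "g \<one>\<^bsub>C\<^esub> = (\<Prod>r\<in>R. \<psi> r \<one>\<^bsub>A r\<^esub>)"
    unfolding tau_one[symmetric] by (subst g_tau) (use one_closed in \<open>auto intro!: prod.cong\<close>)
  also have "\<dots> = \<phi> \<one>\<^bsub>A q\<^esub> * (\<Prod>r\<in>R - {q}. \<epsilon> r \<one>\<^bsub>A r\<^esub>)"
    using finite_R q by (subst prod.remove[of _ q]) (auto simp: \<psi>_def intro!: prod.cong)
  also have "(\<Prod>r\<in>R - {q}. \<epsilon> r \<one>\<^bsub>A r\<^esub>) = 1"
    using \<epsilon> by (intro prod.neutral) (auto simp: cstar_hom_def complex_cstar_def)
  also have "(\<Sum>js\<in>tuples (Pi\<^sub>E R X) (length e). \<xi> js * g (tensor_power C U e is js)) =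
      (\<Sum>js\<in>tuples (Pi\<^sub>E R X) (length e).
        F (components R js) * (\<Prod>r\<in>R. \<psi> r (?w r (components R js r))))"
  proof (intro sum.cong refl)
    fix js assume js: "js \<in> tuples (Pi\<^sub>E R X) (length e)"
    have "(\<lambda>r\<in>R. ?w r (components R js r)) \<in> (\<Pi>\<^sub>E r\<in>R. carrier (A r))"
      using w components_in[OF js] by (auto simp: PiE_iff)
    then have "g (\<tau> (\<lambda>r\<in>R. ?w r (components R js r))) = (\<Prod>r\<in>R. \<psi> r (?w r (components R js r)))"
      by (subst g_tau) (auto intro!: prod.cong)
    then show "\<xi> js * g (tensor_power C U e is js) =
        F (components R js) * (\<Prod>r\<in>R. \<psi> r (?w r (components R js r)))"
      by (simp only: tensor_power_U[OF "is" js] comp F[OF js])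
  qed
  also have "\<dots> = (\<Sum>t'\<in>Pi\<^sub>E R ?T. F t' * (\<Prod>r\<in>R. \<psi> r (?w r (t' r))))"
    by (rule sum.reindex_bij_betw[OF bij_betw_components])
  also have "\<dots> = (\<Sum>j\<in>?T q. F (t0(q := j)) * (\<Prod>r\<in>R. \<psi> r (?w r ((t0(q := j)) r))))"
  proof (rule sum_PiE_slice[OF finite_R _ t0 q])
    show "finite (?T r)" if "r \<in> R" for r using finite_X[OF that] by (rule finite_tuples)
    fix t' r assume *: "t' \<in> Pi\<^sub>E R ?T" "r \<in> R" "r \<noteq> q" "t' r \<noteq> t0 r"
    then have "\<psi> r (?w r (t' r)) = 0" using \<epsilon>w[of r "t' r"] by (auto simp: \<psi>_def)
    then show "F t' * (\<Prod>r\<in>R. \<psi> r (?w r (t' r))) = 0"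
      using *(2) finite_R by (auto simp: prod_zero_iff)
  qed
  also have "\<dots> = (\<Sum>j\<in>?T q. ?\<eta> j * \<phi> (tensor_power (A q) (u q) e i j))"
  proof (intro sum.cong refl)
    fix j assume j: "j \<in> ?T q"
    have "(\<Prod>r\<in>R. \<psi> r (?w r ((t0(q := j)) r))) =
        \<phi> (?w q j) * (\<Prod>r\<in>R - {q}. \<psi> r (?w r ((t0(q := j)) r)))"
      using finite_R q by (subst prod.remove[of _ q]) (auto simp: \<psi>_def)
    also have "(\<Prod>r\<in>R - {q}. \<psi> r (?w r ((t0(q := j)) r))) = 1"
      using \<epsilon>w t0 by (intro prod.neutral) (auto simp: \<psi>_def PiE_iff)
    finally have eq: "(\<Prod>r\<in>R. \<psi> r (?w r ((t0(q := j)) r))) = \<phi> (?w q j)" by simp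
    show "F (t0(q := j)) * (\<Prod>r\<in>R. \<psi> r (?w r ((t0(q := j)) r))) =
        ?\<eta> j * \<phi> (tensor_power (A q) (u q) e i j)"
      unfolding eq using j by (simp add: t0_def)
  qed
  finally show "(\<Sum>j\<in>?T q. ?\<eta> j * \<phi> (tensor_power (A q) (u q) e i j)) = ?\<eta> i * \<phi> \<one>\<^bsub>A q\<^esub>"
    using i F[OF "is"] by (simp add: comp t0_def)
qed (auto split: if_splits)

text \<open>The fixed vectors of the product lie in the tensor product of the spans of the \<open>v r\<close>.\<close>

lemma Fix_space_expansion:
  assumes \<epsilon>: "\<And>r. r \<in> R \<Longrightarrow> \<epsilon> r \<in> cstar_hom (A r) complex_cstar"
    and counit: "\<And>r i j. r \<in> R \<Longrightarrow> i \<in> X r \<Longrightarrow> j \<in> X r \<Longrightarrow> \<epsilon> r (u r i j) = of_bool (i = j)"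
    and P: "\<And>r. r \<in> R \<Longrightarrow> finite (P r)"
    and span: "\<And>r \<eta>. r \<in> R \<Longrightarrow> \<eta> \<in> Fix_space (X r) (A r) (u r) e \<Longrightarrow>
      \<exists>c. \<forall>j\<in>tuples (X r) (length e). \<eta> j = (\<Sum>\<pi>\<in>P r. c \<pi> * v r \<pi> j)"
    and \<xi>: "\<xi> \<in> Fix_space (Pi\<^sub>E R X) C U e"
  shows "\<exists>c. \<forall>is\<in>tuples (Pi\<^sub>E R X) (length e).
    \<xi> is = (\<Sum>\<pi>\<in>Pi\<^sub>E R P. c \<pi> * (\<Prod>r\<in>R. v r (\<pi> r) (components R is r)))"
proof -
  let ?T = "\<lambda>r. tuples (X r) (length e)"
  let ?S = "tuples (Pi\<^sub>E R X) (length e)"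
  define F where "F t = \<xi> (the_inv_into ?S (components R) t)" for t
  have F: "F (components R is) = \<xi> is" if "is \<in> ?S" for "is"
    unfolding F_def using bij_betw_components that by (metis bij_betw_def the_inv_into_f_f)
  have slice: "\<exists>c. \<forall>j\<in>?T r. F (t(r := j)) = (\<Sum>\<pi>\<in>P r. c \<pi> * v r \<pi> j)"
    if "r \<in> R" "t \<in> Pi\<^sub>E R ?T" for r t
    using span[OF that(1) slice_in_Fix_space[OF \<epsilon> counit \<xi> F that(2,1)]] by simp
  have "\<exists>c. (\<forall>\<pi> t t'. (\<forall>r. r \<notin> R \<longrightarrow> t r = t' r) \<longrightarrow> c \<pi> t = c \<pi> t') \<and>
      (\<forall>t\<in>Pi\<^sub>E R ?T. F t = (\<Sum>\<pi>\<in>Pi\<^sub>E R P. c \<pi> t * (\<Prod>r\<in>R. v r (\<pi> r) (t r))))"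
  proof (rule ex_tensor_expansion[OF finite_R subset_refl])
    show "finite (?T r)" if "r \<in> R" for r using finite_X[OF that] by (rule finite_tuples)
  qed (fact P slice)+
  then obtain c where c: "\<forall>\<pi> t t'. (\<forall>r. r \<notin> R \<longrightarrow> t r = t' r) \<longrightarrow> c \<pi> t = c \<pi> t'"
    and exp: "\<forall>t\<in>Pi\<^sub>E R ?T. F t = (\<Sum>\<pi>\<in>Pi\<^sub>E R P. c \<pi> t * (\<Prod>r\<in>R. v r (\<pi> r) (t r)))"
    by (elim exE conjE) (rule that)
  have "\<xi> is = (\<Sum>\<pi>\<in>Pi\<^sub>E R P. c \<pi> (\<lambda>_. undefined) * (\<Prod>r\<in>R. v r (\<pi> r) (components R is r)))"
    if "is": "is \<in> ?S" for "is"
  proof -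
    have const: "c \<pi> (components R is) = c \<pi> (\<lambda>_. undefined)" for \<pi>
      by (intro c[rule_format]) (simp add: components_def)
    show ?thesis using bspec[OF exp components_in[OF "is"]] unfolding F[OF "is"] const .
  qed
  then show ?thesis by (intro exI ballI)
qed

end

section \<open>Easy quantum groups\<close>

lemma tuples_0 [simp]: "tuples X 0 = {[]}"
  by (auto simp: tuples_def)

lemma easy_quantum_groupD:
  assumes "easy_quantum_group N A u D"
  shows "cstar_algebra A"
    and "\<And>i j. i \<in> {1..N} \<Longrightarrow> j \<in> {1..N} \<Longrightarrow> u i j \<in> carrier A"
    and "\<exists>\<epsilon>\<in>cstar_hom A complex_cstar. \<forall>i\<in>{1..N}. \<forall>j\<in>{1..N}. \<epsilon> (u i j) = (if i = j then 1 else 0)"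
    and "D [] e \<subseteq> partitions 0 (length e)"
    and "Hom_space {1..N} A u k e =
      {T. \<exists>c. T = (\<lambda>js is. \<Sum>\<pi>\<in>D k e. c \<pi> * partition_map {1..N} (length k) (length e) \<pi> js is)}"
proof -
  note easy = assms[unfolded easy_quantum_group_def]
  then have hopf: "hopf_cstar_algebra N A u" by (simp add: closed_quantum_subgroup_def)
  then show "cstar_algebra A"
    and "\<exists>\<epsilon>\<in>cstar_hom A complex_cstar. \<forall>i\<in>{1..N}. \<forall>j\<in>{1..N}. \<epsilon> (u i j) = (if i = j then 1 else 0)"
    unfolding hopf_cstar_algebra_def by blast+
  have "{u i j | i j. i \<in> {1..N} \<and> j \<in> {1..N}} \<subseteq> carrier A"
    using hopf unfolding hopf_cstar_algebra_def generates_def by blast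
  then show "\<And>i j. i \<in> {1..N} \<Longrightarrow> j \<in> {1..N} \<Longrightarrow> u i j \<in> carrier A" by blast
  have "\<forall>k l. D k l \<subseteq> partitions (length k) (length l)"
    using easy unfolding category_of_partitions_def by blast
  from this[rule_format, of "[]" e] show "D [] e \<subseteq> partitions 0 (length e)" by simp
  show "Hom_space {1..N} A u k e =
      {T. \<exists>c. T = (\<lambda>js is. \<Sum>\<pi>\<in>D k e. c \<pi> * partition_map {1..N} (length k) (length e) \<pi> js is)}"
    using easy by blast
qed

lemma finite_partitions: "finite (partitions k l)"
proof (rule finite_subset)
  show "partitions k l \<subseteq> Pow (Pow ({..<k} <+> {..<l}))"
    by (auto simp: partitions_def partition_on_def)
qed simp

lemma easy_Fix_space_iff:
  assumes "easy_quantum_group N A u D"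
  shows "\<xi> \<in> Fix_space {1..N} A u e \<longleftrightarrow>
    (\<exists>c. \<xi> = (\<lambda>js. \<Sum>\<pi>\<in>D [] e. c \<pi> * partition_map {1..N} 0 (length e) \<pi> js []))"
proof -
  note easy = easy_quantum_groupD[OF assms]
  have eq: "(\<lambda>js is. if is = [] then \<xi> js else 0) =
      (\<lambda>js is. \<Sum>\<pi>\<in>D [] e. c \<pi> * partition_map {1..N} (length []) (length e) \<pi> js is) \<longleftrightarrow>
      \<xi> = (\<lambda>js. \<Sum>\<pi>\<in>D [] e. c \<pi> * partition_map {1..N} 0 (length e) \<pi> js [])" for c
    by (auto simp: fun_eq_iff partition_map_def)
  have "\<xi> \<in> Fix_space {1..N} A u e \<longleftrightarrow>
      (\<lambda>js is. if is = [] then \<xi> js else 0) \<in> Hom_space {1..N} A u [] e"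
    by (rule Fix_space_eq_Hom_space[OF easy(1) _ finite_atLeastAtMost]) (rule easy(2))
  then show ?thesis
    unfolding easy(5) by (simp only: mem_Collect_eq eq)
qed

lemma partition_vector_in_Fix_space:
  assumes "easy_quantum_group N A u D" "\<pi> \<in> D [] e"
  shows "(\<lambda>js. partition_map {1..N} 0 (length e) \<pi> js []) \<in> Fix_space {1..N} A u e"
proof -
  have "finite (D [] e)"
    using easy_quantum_groupD(4)[OF assms(1)] finite_partitions by (rule finite_subset)
  then have eq: "(\<Sum>\<sigma>\<in>D [] e. (if \<sigma> = \<pi> then 1 else 0) * f \<sigma>) = f \<pi>" for f :: "_ \<Rightarrow> complex"
    using assms(2) by (simp add: if_distrib[of "\<lambda>x. x * _"] cong: if_cong)
  show ?thesis
    by (rule easy_Fix_space_iff[OF assms(1), THEN iffD2], rule exI, rule ext, rule eq[symmetric])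
qed


section \<open>Evaluation at the diagonal indices\<close>

lemma superposition_props:
  assumes "\<forall>\<pi>\<in>P. \<forall>B\<in>\<pi>. B \<subseteq> X \<and> B \<noteq> {}"
  shows "partition_on X (superposition X P)"
    and "\<pi> \<in> P \<Longrightarrow> coarsens (superposition X P) \<pi>"
    and "partition_on X \<rho> \<Longrightarrow> (\<And>\<pi>. \<pi> \<in> P \<Longrightarrow> coarsens \<rho> \<pi>) \<Longrightarrow> refines X (superposition X P) \<rho>"
proof -
  note * = theI'[OF ex1_superposition[OF assms[rule_format]], folded superposition_def]
  show "partition_on X (superposition X P)" by (rule *[THEN conjunct1])
  show "coarsens (superposition X P) \<pi>" if "\<pi> \<in> P"
    using *[THEN conjunct2, THEN conjunct1] that by (rule bspec)
  show "refines X (superposition X P) \<rho>"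
    if "partition_on X \<rho>" "\<And>\<pi>. \<pi> \<in> P \<Longrightarrow> coarsens \<rho> \<pi>"
    using *[THEN conjunct2, THEN conjunct2, THEN spec[of _ \<rho>]] that by simp
qed

text \<open>A function that is constant on the blocks of every \<open>\<pi>\<close> has level sets that form a partition
  coarser than every \<open>\<pi>\<close>, hence coarser than the superposition.\<close>

lemma constant_on_superposition_iff:
  assumes P: "\<forall>\<pi>\<in>P. \<forall>B\<in>\<pi>. B \<subseteq> X \<and> B \<noteq> {}"
  shows "(\<forall>B\<in>superposition X P. \<forall>p\<in>B. \<forall>q\<in>B. f p = f q) \<longleftrightarrow>
    (\<forall>\<pi>\<in>P. \<forall>B\<in>\<pi>. \<forall>p\<in>B. \<forall>q\<in>B. f p = f q)" (is "?L \<longleftrightarrow> ?R")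
proof
  assume L: ?L
  show ?R
  proof (intro ballI)
    fix \<pi> B p q assume *: "\<pi> \<in> P" "B \<in> \<pi>" "p \<in> B" "q \<in> B"
    then obtain B' where "B' \<in> superposition X P" "B \<subseteq> B'"
      using superposition_props(2)[OF P *(1)] unfolding coarsens_def by blast
    then show "f p = f q" using L * by blast
  qed
next
  assume R: ?R
  define \<rho> where "\<rho> = (\<lambda>p. {q \<in> X. f q = f p}) ` X"
  have "partition_on X \<rho>"
    unfolding partition_on_def
  proof (intro conjI)
    show "\<Union>\<rho> = X" "{} \<notin> \<rho>" unfolding \<rho>_def by blast+
    show "disjoint \<rho>"
      unfolding disjoint_def
    proof (intro ballI impI)
      fix B C assume "B \<in> \<rho>" "C \<in> \<rho>" "B \<noteq> C"
      then obtain p q where *: "B = {x \<in> X. f x = f p}" "C = {x \<in> X. f x = f q}"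
        unfolding \<rho>_def by blast
      then have "f p \<noteq> f q" using \<open>B \<noteq> C\<close> by metis
      then show "B \<inter> C = {}" unfolding * by auto
    qed
  qed
  moreover have "coarsens \<rho> \<pi>" if \<pi>: "\<pi> \<in> P" for \<pi>
    unfolding coarsens_def
  proof
    fix B assume B: "B \<in> \<pi>"
    have BX: "B \<subseteq> X" "B \<noteq> {}" using bspec[OF bspec[OF P \<pi>] B] by simp_all
    then obtain p where p: "p \<in> B" by blast
    have "f q = f p" if "q \<in> B" for q
      using bspec[OF bspec[OF bspec[OF bspec[OF R \<pi>] B] that] p] .
    then have "B \<subseteq> {q \<in> X. f q = f p}" using BX(1) by blast
    moreover have "{q \<in> X. f q = f p} \<in> \<rho>" unfolding \<rho>_def using BX(1) p by blast
    ultimately show "\<exists>C\<in>\<rho>. B \<subseteq> C" by blast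
  qed
  ultimately have ref: "refines X (superposition X P) \<rho>" by (rule superposition_props(3)[OF P])
  show ?L
  proof (intro ballI)
    fix B p q assume *: "B \<in> superposition X P" "p \<in> B" "q \<in> B"
    then obtain C where C: "C \<in> \<rho>" "B \<subseteq> C" using ref unfolding refines_def by blast
    then obtain x where "C = {q \<in> X. f q = f x}" unfolding \<rho>_def by blast
    then have "f p = f x" "f q = f x" using C(2) *(2,3) by blast+
    then show "f p = f q" by simp
  qed
qed

text \<open>Such a tuple amounts to the choice of one value in \<open>J\<close> for each block of \<open>\<sigma>\<close>.\<close>

lemma card_constant_tuples:
  assumes \<sigma>: "partition_on ({..<0} <+> {..<k}) \<sigma>"
  shows "card {cs \<in> tuples J k. \<forall>B\<in>\<sigma>. \<forall>p\<in>B. \<forall>q\<in>B.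
      case_sum (nth []) (nth cs) p = case_sum (nth []) (nth cs) q} = card J ^ card \<sigma>"
    (is "card ?S = _")
proof -
  let ?f = "\<lambda>cs. case_sum (nth []) (nth cs)"
  define block where "block p = (THE B. B \<in> \<sigma> \<and> Inr p \<in> B)" for p :: nat
  have block: "block p = B" if "B \<in> \<sigma>" "Inr p \<in> B" for p B
    unfolding block_def
  proof (rule the_equality)
    show "C = B" if "C \<in> \<sigma> \<and> Inr p \<in> C" for C
      using that \<open>B \<in> \<sigma>\<close> \<open>Inr p \<in> B\<close> partition_onD2[OF \<sigma>] unfolding disjoint_def by blast
  qed (use that in blast)
  have block_in: "block p \<in> \<sigma>" "Inr p \<in> block p" if p: "p < k" for p
  proof -
    have "Inr p \<in> \<Union>\<sigma>" using p partition_onD1[OF \<sigma>] by auto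
    then obtain B where "B \<in> \<sigma>" "Inr p \<in> B" by blast
    then show "block p \<in> \<sigma>" "Inr p \<in> block p" using block by auto
  qed
  \<comment> \<open>a leg representing the block\<close>
  define pt where "pt B = (SOME p. Inr p \<in> B)" for B :: "(nat + nat) set"
  have pt: "Inr (pt B) \<in> B" "pt B < k" if B: "B \<in> \<sigma>" for B
  proof -
    have "B \<subseteq> {..<0} <+> {..<k}" "B \<noteq> {}" using B partition_onD1[OF \<sigma>] partition_onD3[OF \<sigma>] by auto
    then have "\<exists>p. Inr p \<in> B" by blast
    then show "Inr (pt B) \<in> B" unfolding pt_def by (rule someI_ex)
    then show "pt B < k" using \<open>B \<subseteq> _\<close> by auto
  qed
  have "bij_betw (\<lambda>cs. \<lambda>B\<in>\<sigma>. cs ! pt B) ?S (\<sigma> \<rightarrow>\<^sub>E J)"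
  proof (rule bij_betwI[where g = "\<lambda>t. map (\<lambda>p. t (block p)) [0..<k]"])
    show "(\<lambda>cs. \<lambda>B\<in>\<sigma>. cs ! pt B) \<in> ?S \<rightarrow> (\<sigma> \<rightarrow>\<^sub>E J)"
      using pt by (auto simp: tuples_def subset_iff)
    show "(\<lambda>t. map (\<lambda>p. t (block p)) [0..<k]) \<in> (\<sigma> \<rightarrow>\<^sub>E J) \<rightarrow> ?S"
    proof
      fix t assume t: "t \<in> \<sigma> \<rightarrow>\<^sub>E J"
      let ?cs = "map (\<lambda>p. t (block p)) [0..<k]"
      have "?cs \<in> tuples J k" using t block_in by (auto simp: tuples_def)
      moreover have "?f ?cs p = t B" if B: "B \<in> \<sigma>" and p: "p \<in> B" for B p
      proof -
        have "p \<in> {..<0} <+> {..<k}" using B p partition_onD1[OF \<sigma>] by auto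
        then obtain p' where "p = Inr p'" "p' < k" by auto
        then show ?thesis using block[OF B] p by simp
      qed
      ultimately show "?cs \<in> ?S" by auto
    qed
    show "map (\<lambda>p. (\<lambda>B\<in>\<sigma>. cs ! pt B) (block p)) [0..<k] = cs" if cs: "cs \<in> ?S" for cs
    proof (rule nth_equalityI)
      show "length (map (\<lambda>p. (\<lambda>B\<in>\<sigma>. cs ! pt B) (block p)) [0..<k]) = length cs"
        using cs by (simp add: tuples_def)
      fix p assume "p < length (map (\<lambda>p. (\<lambda>B\<in>\<sigma>. cs ! pt B) (block p)) [0..<k])"
      then have p: "p < k" by simp
      have "?f cs (Inr (pt (block p))) = ?f cs (Inr p)"
        using cs block_in[OF p] pt(1)[OF block_in(1)[OF p]] by blast
      then show "map (\<lambda>p. (\<lambda>B\<in>\<sigma>. cs ! pt B) (block p)) [0..<k] ! p = cs ! p"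
        using p block_in[OF p] by simp
    qed
    show "(\<lambda>B\<in>\<sigma>. map (\<lambda>p. t (block p)) [0..<k] ! pt B) = t" if t: "t \<in> \<sigma> \<rightarrow>\<^sub>E J" for t
    proof
      fix B
      show "(\<lambda>B\<in>\<sigma>. map (\<lambda>p. t (block p)) [0..<k] ! pt B) B = t B"
        using t pt[of B] block[of B "pt B"] by (cases "B \<in> \<sigma>") auto
    qed
  qed
  then have "card ?S = card (\<sigma> \<rightarrow>\<^sub>E J)" by (rule bij_betw_same_card)
  also have "\<dots> = card J ^ card \<sigma>"
  proof (rule card_funcsetE)
    have "\<sigma> \<subseteq> Pow ({..<0} <+> {..<k})" using partition_onD1[OF \<sigma>] by auto
    then show "finite \<sigma>" by (rule finite_subset) simp
  qed
  finally show ?thesis .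
qed

lemma prod_of_bool: "finite R \<Longrightarrow> (\<Prod>r\<in>R. of_bool (P r)) = (of_bool (\<forall>r\<in>R. P r) :: complex)"
  by (induction R rule: finite_induct) auto

lemma bij_betw_diagonal_tuples:
  assumes "s \<ge> 1"
  shows "bij_betw (map (\<lambda>c. \<lambda>r\<in>{1..s}. c)) (tuples J k) (tuples (diagonal_indices s J) k)"
proof (rule bij_betwI[where g = "map (\<lambda>i. i 1)"])
  let ?d = "\<lambda>c. \<lambda>r\<in>{1..s}. c"
  have d1: "?d c 1 = c" for c :: nat using assms by simp
  show "map ?d \<in> tuples J k \<rightarrow> tuples (diagonal_indices s J) k"
    unfolding tuples_def diagonal_indices_def by (simp add: Pi_iff image_mono)
  show "map (\<lambda>i. i 1) \<in> tuples (diagonal_indices s J) k \<rightarrow> tuples J k"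
  proof -
    have "i 1 \<in> J" if "i \<in> diagonal_indices s J" for i
      using that unfolding diagonal_indices_def by (elim imageE) (simp only: d1)
    then show ?thesis by (auto simp: tuples_def subset_iff)
  qed
  show "map (\<lambda>i. i 1) (map ?d cs) = cs" for cs :: "nat list"
    by (simp only: map_map comp_def d1 list.map_ident)
  show "map ?d (map (\<lambda>i. i 1) bs) = bs" if "bs \<in> tuples (diagonal_indices s J) k" for bs
  proof -
    have "?d (i 1) = i" if "i \<in> diagonal_indices s J" for i
      using that unfolding diagonal_indices_def by (elim imageE) (simp only: d1)
    then have "map (?d \<circ> (\<lambda>i. i 1)) bs = map id bs"
      using that by (intro map_cong) (auto simp: tuples_def)
    then show ?thesis by simp
  qed
qed

lemma card_diagonal_indices: "s \<ge> 1 \<Longrightarrow> card (diagonal_indices s J) = card J"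
  unfolding diagonal_indices_def
  by (intro card_image inj_onI) (auto dest: fun_cong[of _ _ 1])

lemma sum_multi_delta_diagonal:
  assumes s: "s \<ge> 1" and J: "finite J"
    and \<pi>: "\<And>r. r \<in> {1..s} \<Longrightarrow> \<pi> r \<in> partitions 0 k"
  shows "(\<Sum>bs\<in>tuples (diagonal_indices s J) k. multi_delta s \<pi> bs) =
    of_nat (card J ^ card (superposed s k \<pi>))"
proof -
  let ?X = "{..<0::nat} <+> {..<k}"
  have P: "\<forall>\<pi>'\<in>\<pi> ` {1..s}. \<forall>B\<in>\<pi>'. B \<subseteq> ?X \<and> B \<noteq> {}"
    using \<pi> unfolding partitions_def partition_on_def by blast
  have \<sigma>: "partition_on ?X (superposed s k \<pi>)"
    unfolding superposed_def by (rule superposition_props(1)[OF P])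
  have "(\<Sum>bs\<in>tuples (diagonal_indices s J) k. multi_delta s \<pi> bs) =
      (\<Sum>cs\<in>tuples J k. multi_delta s \<pi> (map (\<lambda>c. \<lambda>r\<in>{1..s}. c) cs))"
    by (rule sum.reindex_bij_betw[OF bij_betw_diagonal_tuples[OF s], symmetric])
  also have "\<dots> = (\<Sum>cs\<in>tuples J k. partition_delta (superposed s k \<pi>) [] cs)"
  proof (intro sum.cong refl)
    fix cs :: "nat list"
    have "multi_delta s \<pi> (map (\<lambda>c. \<lambda>r\<in>{1..s}. c) cs) = (\<Prod>r\<in>{1..s}. partition_delta (\<pi> r) [] cs)"
      unfolding multi_delta_def by (intro prod.cong refl) (simp add: comp_def)
    also have "\<dots> = partition_delta (superposed s k \<pi>) [] cs"
      unfolding partition_delta_def prod_of_bool[OF finite_atLeastAtMost] superposed_def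
        constant_on_superposition_iff[OF P, where f = "case_sum (nth []) (nth cs)"]
      by simp
    finally show "multi_delta s \<pi> (map (\<lambda>c. \<lambda>r\<in>{1..s}. c) cs) = partition_delta (superposed s k \<pi>) [] cs" .
  qed
  also have "\<dots> = of_nat (card {cs \<in> tuples J k. \<forall>B\<in>superposed s k \<pi>. \<forall>p\<in>B. \<forall>q\<in>B.
      case_sum (nth []) (nth cs) p = case_sum (nth []) (nth cs) q})"
    unfolding partition_delta_def using finite_tuples[OF J]
    by (simp add: Int_def)
  also have "\<dots> = of_nat (card J ^ card (superposed s k \<pi>))"
    unfolding card_constant_tuples[OF \<sigma>] ..
  finally show ?thesis .
qed

text \<open>The normalization \<open>1 / sqrt (|I|^k)\<close> contributes the exponent \<open>- k / 2\<close>, as \<open>|I| = |J|\<close>.\<close>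

lemma diagonal_evaluation:
  assumes s: "s \<ge> 1" and J: "finite J" "J \<noteq> {}"
    and \<pi>: "\<And>r. r \<in> {1..s} \<Longrightarrow> \<pi> r \<in> partitions 0 k"
  shows "complex_of_real (1 / sqrt (real (card (diagonal_indices s J)) ^ k)) *
      (\<Sum>bs\<in>tuples (diagonal_indices s J) k. multi_delta s \<pi> bs) =
    complex_of_real (real (card J) powr (real (card (superposed s k \<pi>)) - real k / 2))"
proof -
  let ?n = "real (card J)" and ?m = "card (superposed s k \<pi>)"
  have n: "?n > 0" using J by (simp add: card_gt_0_iff)
  have "sqrt (?n ^ k) = ?n powr (real k / 2)"
    using n by (simp add: powr_half_sqrt[symmetric] powr_realpow[symmetric] powr_powr)
  then have "?n powr (real ?m - real k / 2) = 1 / sqrt (?n ^ k) * ?n ^ ?m"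
    using n by (simp add: powr_diff powr_realpow)
  moreover have "(of_nat (card J ^ ?m) :: complex) = complex_of_real (?n ^ ?m)" by simp
  moreover have "(\<Sum>bs\<in>tuples (diagonal_indices s J) k. multi_delta s \<pi> bs) = of_nat (card J ^ ?m)"
    by (rule sum_multi_delta_diagonal[OF s J(1)]) (rule \<pi>)
  ultimately show ?thesis
    unfolding card_diagonal_indices[OF s]
    by (simp only: of_real_mult)
qed


section \<open>Ideals and linear combinations of relations\<close>

lemma closed_ideal_generated_mono:
  assumes "\<And>K. ideal K A \<Longrightarrow> (\<And>c x. x \<in> K \<Longrightarrow> c \<odot>\<^bsub>A\<^esub> x \<in> K) \<Longrightarrow> E' \<subseteq> K \<Longrightarrow> E \<subseteq> K"
  shows "closed_ideal_generated A E \<subseteq> closed_ideal_generated A E'"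
  unfolding closed_ideal_generated_def using assms by (intro Inter_anti_mono subsetI CollectI) blast

context cstar_algebra
begin

lemma combination_in_ideal:
  assumes K: "ideal K A" and scale: "\<And>c x. x \<in> K \<Longrightarrow> c \<odot> x \<in> K"
    and "finite P" and y: "\<And>\<pi>. \<pi> \<in> P \<Longrightarrow> y \<pi> \<in> K"
  shows "(\<Oplus>\<pi>\<in>P. c \<pi> \<odot> y \<pi>) \<in> K"
proof -
  have add: "additive_subgroup K A" using K by (rule ideal.axioms)
  have sub: "K \<subseteq> carrier A" using add by (rule additive_subgroup.a_subset)
  show ?thesis
    using assms(3) y
  proof (induction P rule: finite_induct)
    case empty
    show ?case
      using additive_subgroup.zero_closed[OF add] abelian_monoid.finsum_empty[OF abelian_monoid_A]
      by simp
  next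
    case (insert p P)
    have "y \<pi> \<in> carrier A" if "\<pi> \<in> insert p P" for \<pi> using insert.prems[OF that] sub by blast
    then have "(\<Oplus>\<pi>\<in>insert p P. c \<pi> \<odot> y \<pi>) = c p \<odot> y p \<oplus> (\<Oplus>\<pi>\<in>P. c \<pi> \<odot> y \<pi>)"
      using insert.hyps
      by (intro abelian_monoid.finsum_insert[OF abelian_monoid_A]) auto
    then show ?case
      using insert additive_subgroup.a_closed[OF add] scale by simp
  qed
qed

text \<open>A relation \<open>(\<Sum>t. \<xi> t w t) = \<beta>\<close> depends linearly on the pair \<open>(\<xi>, \<beta>)\<close>.\<close>

lemma relation_combination:
  assumes T: "finite T" and P: "finite P" and w: "\<And>t. t \<in> T \<Longrightarrow> w t \<in> carrier A"
    and \<xi>: "\<And>t. t \<in> T \<Longrightarrow> \<xi> t = (\<Sum>\<pi>\<in>P. c \<pi> * v \<pi> t)"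
    and \<beta>: "\<beta> = (\<Sum>\<pi>\<in>P. c \<pi> * b \<pi>)"
  shows "(\<Oplus>t\<in>T. \<xi> t \<odot> w t) \<ominus> \<beta> \<odot> \<one> = (\<Oplus>\<pi>\<in>P. c \<pi> \<odot> ((\<Oplus>t\<in>T. v \<pi> t \<odot> w t) \<ominus> b \<pi> \<odot> \<one>))"
proof -
  have one: "\<one> \<in> carrier A" by (rule ring.ring_simprules(6)[OF ring_A])
  have sum: "(\<Oplus>t\<in>T. f t \<odot> w t) \<in> carrier A" for f :: "_ \<Rightarrow> complex"
    using w by (intro abelian_monoid.finsum_closed[OF abelian_monoid_A]) auto
  have minus: "x \<ominus> y \<in> carrier A" if "x \<in> carrier A" "y \<in> carrier A" for x y
    using that by (rule ring.ring_simprules(4)[OF ring_A])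
  show ?thesis
  proof (rule eq_if_linear_forms_eq)
    show "(\<Oplus>t\<in>T. \<xi> t \<odot> w t) \<ominus> \<beta> \<odot> \<one> \<in> carrier A" using minus[OF sum] one by simp
    show "(\<Oplus>\<pi>\<in>P. c \<pi> \<odot> ((\<Oplus>t\<in>T. v \<pi> t \<odot> w t) \<ominus> b \<pi> \<odot> \<one>)) \<in> carrier A"
      using minus[OF sum] one by (intro abelian_monoid.finsum_closed[OF abelian_monoid_A]) auto
    fix \<phi> assume \<phi>: "\<phi> \<in> linear_forms A"
    have rel: "\<phi> ((\<Oplus>t\<in>T. f t \<odot> w t) \<ominus> \<gamma> \<odot> \<one>) = (\<Sum>t\<in>T. f t * \<phi> (w t)) - \<gamma> * \<phi> \<one>" for f \<gamma>
      using sum one w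
      by (simp add: linear_form_minus[OF \<phi>] linear_form_combination[OF \<phi> T] linear_form_scale[OF \<phi>])
    have "\<phi> (\<Oplus>\<pi>\<in>P. c \<pi> \<odot> ((\<Oplus>t\<in>T. v \<pi> t \<odot> w t) \<ominus> b \<pi> \<odot> \<one>)) =
        (\<Sum>\<pi>\<in>P. c \<pi> * ((\<Sum>t\<in>T. v \<pi> t * \<phi> (w t)) - b \<pi> * \<phi> \<one>))"
      using minus[OF sum] one by (subst linear_form_combination[OF \<phi> P]) (simp_all add: rel)
    also have "\<dots> = (\<Sum>\<pi>\<in>P. \<Sum>t\<in>T. c \<pi> * v \<pi> t * \<phi> (w t)) - (\<Sum>\<pi>\<in>P. c \<pi> * b \<pi>) * \<phi> \<one>"
      by (simp add: right_diff_distrib sum_subtractf sum_distrib_left sum_distrib_right mult.assoc)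
    also have "(\<Sum>\<pi>\<in>P. \<Sum>t\<in>T. c \<pi> * v \<pi> t * \<phi> (w t)) = (\<Sum>t\<in>T. \<xi> t * \<phi> (w t))"
      by (subst sum.swap) (simp add: \<xi> sum_distrib_right)
    finally show "\<phi> ((\<Oplus>t\<in>T. \<xi> t \<odot> w t) \<ominus> \<beta> \<odot> \<one>) =
        \<phi> (\<Oplus>\<pi>\<in>P. c \<pi> \<odot> ((\<Oplus>t\<in>T. v \<pi> t \<odot> w t) \<ominus> b \<pi> \<odot> \<one>))"
      by (simp only: rel \<beta>)
  qed
qed

end

section \<open>The relations defining the space of the product\<close>

theorem theorem7p4:
  fixes s :: nat and N :: "nat \<Rightarrow> nat"
    and A :: "nat \<Rightarrow> 'a cstar" and u :: "nat \<Rightarrow> nat \<Rightarrow> nat \<Rightarrow> 'a"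
    and D :: "nat \<Rightarrow> color list \<Rightarrow> color list \<Rightarrow> legs_partition set"
    and C :: "'c cstar" and \<tau> :: "(nat \<Rightarrow> 'a) \<Rightarrow> 'c"
    and J :: "nat set"
    and S :: "'b cstar" and x :: "(nat \<Rightarrow> nat) \<Rightarrow> 'b"
  assumes "s \<ge> 1"
    and "\<And>r. r \<in> {1..s} \<Longrightarrow> easy_quantum_group (N r) (A r) (u r) (D r)"
    and "cstar_tensor_product {1..s} A C \<tau>"
    and "J \<noteq> {}" and "J \<subseteq> {1..Min (N ` {1..s})}"
    and "free_sphere (multi_indices s N) S x"
  shows "C_X (multi_indices s N) S x C (product_coords s u \<tau>) (diagonal_indices s J) =
    quotient_by_relations S
      {(\<Oplus>\<^bsub>S\<^esub>is\<in>tuples (multi_indices s N) (length e).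
          multi_delta s \<pi> is \<odot>\<^bsub>S\<^esub> color_word S e (map x is),
        complex_of_real
          (real (card J) powr (real (card (superposed s (length e) \<pi>)) - real (length e) / 2))
          \<odot>\<^bsub>S\<^esub> \<one>\<^bsub>S\<^esub>)
       | e \<pi>. \<pi> \<in> (\<Pi> r\<in>{1..s}. D r [] e)}"
proof -
  let ?R = "{1..s}"
  let ?X = "\<lambda>r. {1..N r}"
  let ?M = "multi_indices s N"
  let ?I = "diagonal_indices s J"
  note easy = assms(2)
  have M: "?M = Pi\<^sub>E ?R ?X" by (simp only: multi_indices_def)
  have finite_M: "finite ?M" unfolding M by (intro finite_PiE finite_atLeastAtMost)
  interpret tensor_corepresentation ?R A C \<tau> ?X u
  proof (rule tensor_corepresentation.intro)
    show "cstar_algebra (A r)" if "r \<in> ?R" for r by (rule easy_quantum_groupD(1)[OF easy[OF that]])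
    show "u r i j \<in> carrier (A r)" if "r \<in> ?R" "i \<in> ?X r" "j \<in> ?X r" for r i j
      by (rule easy_quantum_groupD(2)[OF easy[OF that(1)] that(2,3)])
  qed (use assms(3) in simp_all)
  have U: "product_coords s u \<tau> = U"
    by (intro ext) (simp only: product_coords_def U_def)
  interpret S: cstar_algebra S using assms(6) unfolding free_sphere_def by blast
  have "x ` ?M \<subseteq> carrier S" using assms(6) unfolding free_sphere_def generates_def by blast
  then have word: "color_word S e (map x is) \<in> carrier S" if "is \<in> tuples ?M (length e)" for e "is"
    using that unfolding tuples_def by (intro S.color_word_closed) auto
  have J: "finite J" using assms(5) finite_subset by blast
  have "?I \<subseteq> ?M"
  proof
    fix i assume "i \<in> ?I"
    then obtain c where c: "c \<in> J" "i = (\<lambda>r\<in>?R. c)" unfolding diagonal_indices_def by blast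
    have "c \<in> ?X r" if "r \<in> ?R" for r
    proof -
      have "Min (N ` ?R) \<le> N r" using that by (intro Min_le) auto
      then show ?thesis using c(1) assms(5) by fastforce
    qed
    then show "i \<in> ?M" unfolding M c(2) by (intro restrict_PiE_iff[THEN iffD2] ballI)
  qed
  then have I: "tuples ?I k \<subseteq> tuples ?M k" for k unfolding tuples_def by blast
  have "\<forall>r\<in>?R. \<exists>\<epsilon>. \<epsilon> \<in> cstar_hom (A r) complex_cstar \<and>
      (\<forall>i\<in>?X r. \<forall>j\<in>?X r. \<epsilon> (u r i j) = (if i = j then 1 else 0))"
    using easy_quantum_groupD(3)[OF easy] by blast
  then obtain \<epsilon> where \<epsilon>_hom: "\<forall>r\<in>?R. \<epsilon> r \<in> cstar_hom (A r) complex_cstar \<and>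
      (\<forall>i\<in>?X r. \<forall>j\<in>?X r. \<epsilon> r (u r i j) = (if i = j then 1 else 0))"
    by (rule bchoice[THEN exE])
  have \<epsilon>: "\<epsilon> r \<in> cstar_hom (A r) complex_cstar" if "r \<in> ?R" for r using \<epsilon>_hom that by blast
  have counit: "\<epsilon> r (u r i j) = of_bool (i = j)" if "r \<in> ?R" "i \<in> ?X r" "j \<in> ?X r" for r i j
    using \<epsilon>_hom that by auto
  have multi_delta: "multi_delta s \<pi> is = (\<Prod>r\<in>?R. partition_delta (\<pi> r) [] (components ?R is r))"
    for \<pi> "is"
    unfolding multi_delta_def components_def by (intro prod.cong refl) simp
  let ?\<beta> = "\<lambda>e \<xi>. complex_of_real (1 / sqrt (real (card ?I) ^ length e)) *
    (\<Sum>bs\<in>tuples ?I (length e). \<xi> bs)"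
  let ?b = "\<lambda>e \<pi>. complex_of_real
    (real (card J) powr (real (card (superposed s (length e) \<pi>)) - real (length e) / 2))"
  let ?rel = "\<lambda>e \<xi> \<gamma>. (\<Oplus>\<^bsub>S\<^esub>is\<in>tuples ?M (length e). \<xi> is \<odot>\<^bsub>S\<^esub> color_word S e (map x is))
    \<ominus>\<^bsub>S\<^esub> \<gamma> \<odot>\<^bsub>S\<^esub> \<one>\<^bsub>S\<^esub>"
  \<comment> \<open>\<open>?\<beta> e \<xi>\<close> is the value that the defining relations of \<open>X_{G,I}\<close> assign to \<open>\<xi>\<close>; on partition
    vectors it is the value \<open>?b e \<pi>\<close> in the theorem.\<close>
  have \<beta>: "?\<beta> e (multi_delta s \<pi>) = ?b e \<pi>" if "\<pi> \<in> (\<Pi> r\<in>?R. D r [] e)" for e \<pi>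
  proof (rule diagonal_evaluation[OF assms(1) J assms(4)])
    show "\<pi> r \<in> partitions 0 (length e)" if "r \<in> ?R" for r
      using easy_quantum_groupD(4)[OF easy[OF that]] \<open>\<pi> \<in> _\<close> that by blast
  qed
  let ?E = "{(\<Oplus>\<^bsub>S\<^esub>is\<in>tuples ?M (length e). \<xi> is \<odot>\<^bsub>S\<^esub> color_word S e (map x is), ?\<beta> e \<xi> \<odot>\<^bsub>S\<^esub> \<one>\<^bsub>S\<^esub>)
      | e \<xi>. \<xi> \<in> Fix_space ?M C (product_coords s u \<tau>) e}"
  let ?E' = "{(\<Oplus>\<^bsub>S\<^esub>is\<in>tuples ?M (length e). multi_delta s \<pi> is \<odot>\<^bsub>S\<^esub> color_word S e (map x is), ?b e \<pi> \<odot>\<^bsub>S\<^esub> \<one>\<^bsub>S\<^esub>)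
      | e \<pi>. \<pi> \<in> (\<Pi> r\<in>?R. D r [] e)}"
  let ?diff = "\<lambda>(a, b). a \<ominus>\<^bsub>S\<^esub> b"
  have "closed_ideal_generated S (?diff ` ?E) \<subseteq> closed_ideal_generated S (?diff ` ?E')"
  proof (rule closed_ideal_generated_mono)
    fix K assume K: "ideal K S" "\<And>c x. x \<in> K \<Longrightarrow> c \<odot>\<^bsub>S\<^esub> x \<in> K" "?diff ` ?E' \<subseteq> K"
    have rel: "?rel e (multi_delta s \<pi>) (?b e \<pi>) \<in> K" if "\<pi> \<in> (\<Pi> r\<in>?R. D r [] e)" for e \<pi>
      using that by (intro subsetD[OF K(3)]) force
    show "?diff ` ?E \<subseteq> K"
    proof
      fix z assume "z \<in> ?diff ` ?E"
      then obtain e \<xi> where \<xi>: "\<xi> \<in> Fix_space ?M C (product_coords s u \<tau>) e"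
        and z: "z = ?rel e \<xi> (?\<beta> e \<xi>)"
        by (elim imageE CollectE exE conjE) (simp only: prod.case)
      let ?P = "\<Pi>\<^sub>E r\<in>?R. D r [] e"
      have finite_D: "finite (D r [] e)" if "r \<in> ?R" for r
        using easy_quantum_groupD(4)[OF easy[OF that]] finite_partitions by (rule finite_subset)
      have span: "\<exists>c. \<forall>j\<in>tuples (?X r) (length e). \<eta> j = (\<Sum>\<pi>\<in>D r [] e. c \<pi> * partition_delta \<pi> [] j)"
        if r: "r \<in> ?R" and \<eta>: "\<eta> \<in> Fix_space (?X r) (A r) (u r) e" for r \<eta>
      proof -
        obtain c where "\<eta> = (\<lambda>js. \<Sum>\<pi>\<in>D r [] e. c \<pi> * partition_map (?X r) 0 (length e) \<pi> js [])"
          using \<eta> unfolding easy_Fix_space_iff[OF easy[OF r]] by blast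
        then show ?thesis by (intro exI[of _ c]) (simp add: partition_map_def)
      qed
      have "\<exists>c. \<forall>is\<in>tuples (Pi\<^sub>E ?R ?X) (length e). \<xi> is =
          (\<Sum>\<pi>\<in>?P. c \<pi> * (\<Prod>r\<in>?R. partition_delta (\<pi> r) [] (components ?R is r)))"
        using \<xi> unfolding M U
        by (rule Fix_space_expansion[rotated 4]) (fact \<epsilon> counit finite_D span)+
      then obtain c where c: "\<And>is. is \<in> tuples ?M (length e) \<Longrightarrow>
          \<xi> is = (\<Sum>\<pi>\<in>?P. c \<pi> * multi_delta s \<pi> is)"
        unfolding M multi_delta by blast
      have "?\<beta> e \<xi> = (\<Sum>\<pi>\<in>?P. c \<pi> * ?\<beta> e (multi_delta s \<pi>))"
      proof -
        have "(\<Sum>bs\<in>tuples ?I (length e). \<xi> bs) =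
            (\<Sum>bs\<in>tuples ?I (length e). \<Sum>\<pi>\<in>?P. c \<pi> * multi_delta s \<pi> bs)"
          using I by (intro sum.cong refl c) blast
        also have "\<dots> = (\<Sum>\<pi>\<in>?P. c \<pi> * (\<Sum>bs\<in>tuples ?I (length e). multi_delta s \<pi> bs))"
          unfolding sum_distrib_left by (rule sum.swap)
        finally show ?thesis unfolding sum_distrib_left[of _ _ ?P] by (simp only: sum_distrib_left mult.left_commute)
      qed
      also have "\<dots> = (\<Sum>\<pi>\<in>?P. c \<pi> * ?b e \<pi>)"
        by (intro sum.cong refl arg_cong2[of _ _ _ _ "(*)"] \<beta>) auto
      finally have "z = (\<Oplus>\<^bsub>S\<^esub>\<pi>\<in>?P. c \<pi> \<odot>\<^bsub>S\<^esub> ?rel e (multi_delta s \<pi>) (?b e \<pi>))"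
        unfolding z by (intro S.relation_combination finite_tuples[OF finite_M] finite_PiE
          finite_atLeastAtMost finite_D word c)
      also have "\<dots> \<in> K"
      proof (rule S.combination_in_ideal[OF K(1,2)])
        show "finite ?P" by (intro finite_PiE finite_atLeastAtMost finite_D)
        show "?rel e (multi_delta s \<pi>) (?b e \<pi>) \<in> K" if "\<pi> \<in> ?P" for \<pi>
          using that by (intro rel) auto
      qed
      finally show "z \<in> K" .
    qed
  qed
  moreover have "closed_ideal_generated S (?diff ` ?E') \<subseteq> closed_ideal_generated S (?diff ` ?E)"
  proof (rule closed_ideal_generated_mono)
    fix K assume K: "?diff ` ?E \<subseteq> K"
    show "?diff ` ?E' \<subseteq> K"
    proof
      fix z assume "z \<in> ?diff ` ?E'"
      then obtain e \<pi> where \<pi>: "\<pi> \<in> (\<Pi> r\<in>?R. D r [] e)"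
        and z: "z = ?rel e (multi_delta s \<pi>) (?b e \<pi>)"
        by (elim imageE CollectE exE conjE) (simp only: prod.case)
      \<comment> \<open>Vectors in \<open>Fix_space\<close> vanish off the tuples of multi-indices.\<close>
      define \<xi> where "\<xi> is = (if is \<in> tuples ?M (length e) then multi_delta s \<pi> is else 0)" for "is"
      let ?\<eta> = "\<lambda>r js. partition_map (?X r) 0 (length e) (\<pi> r) js []"
      have "(\<lambda>is. if is \<in> tuples (Pi\<^sub>E ?R ?X) (length e) then \<Prod>r\<in>?R. ?\<eta> r (components ?R is r) else 0)
          \<in> Fix_space (Pi\<^sub>E ?R ?X) C U e"
      proof (rule tensor_product_in_Fix_space)
        show "?\<eta> r \<in> Fix_space (?X r) (A r) (u r) e" if "r \<in> ?R" for r
          using \<pi> that by (intro partition_vector_in_Fix_space[OF easy[OF that]]) blast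
      qed
      also have "(\<lambda>is. if is \<in> tuples (Pi\<^sub>E ?R ?X) (length e)
          then \<Prod>r\<in>?R. ?\<eta> r (components ?R is r) else 0) = \<xi>"
      proof
        fix "is"
        show "(if is \<in> tuples (Pi\<^sub>E ?R ?X) (length e)
          then \<Prod>r\<in>?R. ?\<eta> r (components ?R is r) else 0) = \<xi> is"
        proof (cases "is \<in> tuples (Pi\<^sub>E ?R ?X) (length e)")
          case True
          show ?thesis
            unfolding \<xi>_def M if_P[OF True] multi_delta partition_map_def
            using components_in[OF True] by (intro prod.cong refl) (auto simp: PiE_iff)
        qed (simp only: \<xi>_def M if_False)
      qed
      finally have \<xi>: "\<xi> \<in> Fix_space ?M C (product_coords s u \<tau>) e" unfolding M U .
      have "?rel e \<xi> (?\<beta> e \<xi>) \<in> K" using \<xi> by (intro subsetD[OF K]) force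
      also have "?\<beta> e \<xi> = ?\<beta> e (multi_delta s \<pi>)"
        using I[of "length e"] unfolding \<xi>_def by (intro arg_cong2[of _ _ _ _ "(*)"] refl sum.cong) auto
      also have "\<dots> = ?b e \<pi>" by (rule \<beta>[OF \<pi>])
      also have "?rel e \<xi> (?b e \<pi>) = z"
        unfolding z \<xi>_def
        by (intro arg_cong2[of _ _ _ _ "a_minus S"] refl
          abelian_monoid.finsum_cong'[OF S.abelian_monoid_A] funcsetI) (simp_all add: word)
      finally show "z \<in> K" .
    qed
  qed
  ultimately have "closed_ideal_generated S (?diff ` ?E) = closed_ideal_generated S (?diff ` ?E')"
    by (rule subset_antisym)
  then show ?thesis unfolding C_X_def quotient_by_relations_def by (rule arg_cong)
qed

end
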